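(* Fix $\Delta>0$. The probability that a run of the protocol $\mathrm{PA\text{-}CORE}(\Delta)$ is correct is at least $\Psi(n)\cdot\left(1-e^{-0.5\lambda\Delta}\right)^{(n+1)^2}$, where $$\Psi(n)=\max\left\{0,\ 1-\left(1-\frac{\ln n}{2\sqrt n}\right)^{2n}n^{1+\sqrt n}-\left(1+\frac{\ln n}{2\sqrt n}\right)^{2n}n^{1-\sqrt n}\right\}.$$
   Context: Setting: a supervisor $i_0$ and $n+1$ worker agents $i_1,\ldots,i_{n+1}$, connected by a complete reliable network; each message's delay is an independent exponential random variable with parameter $\lambda$. There is no global clock: each agent $i_k$ has a local clock $C_{i_k}(t)$ that measures elapsed time accurately but may be offset by an unknown constant; $C_{i_0}(t)=t$, and $i_0$ receives an external input at time $t=0$. Let $\delta=\frac{\ln n}{\lambda\sqrt n}$. Protocol $\mathrm{PA\text{-}CORE}(\Delta)$: at time $0$, $i_0$ sends "trigger" to all workers. Upon receiving "trigger", a worker sends "redirect" to each of the other $n$ workers. Each worker $i_k$ records its local clock readings $\tau_1,\ldots,\tau_n$ at the arrivals of the $n$ "redirect" messages it receives; upon the $n$-th one it computes $T=\frac1n\sum_{m=1}^n\tau_m-\frac{2}{\lambda}$, defines the adjusted clock $C^{Adj}_{i_k}(t)=C_{i_k}(t)-T$, waits until $C^{Adj}_{i_k}(t)\ge \Delta+2\delta(k-1)$ (not waiting if this already holds), and performs its action $\alpha_k$. With $t_k$ the time at which $i_k$ performs $\alpha_k$, a run is correct if $t_1\le t_2\le\cdots\le t_{n+1}<\infty$. 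*)

theory Defs
  imports "HOL-Probability.Probability"
begin

text \<open>Agents: supervisor 0, workers 1..n+1. A message is indexed by (sender, receiver):
  (0,k) is the trigger to worker k, (j,k) with j,k workers, j \<noteq> k, is the redirect from j to k.\<close>

definition workers :: "nat \<Rightarrow> nat set" where
  "workers n = {1..n+1}"

definition msgs :: "nat \<Rightarrow> (nat \<times> nat) set" where
  "msgs n = {(0, k) | k. k \<in> workers n} \<union>
            {(j, k) | j k. j \<in> workers n \<and> k \<in> workers n \<and> j \<noteq> k}"

definition delay_space :: "real \<Rightarrow> nat \<Rightarrow> (nat \<times> nat \<Rightarrow> real) measure" where
  "delay_space l n = PiM (msgs n) (\<lambda>_. density lborel (exponential_density l))"

definition others :: "nat \<Rightarrow> nat \<Rightarrow> nat set" where
  "others n k = workers n - {k}"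

definition arrival :: "(nat \<times> nat \<Rightarrow> real) \<Rightarrow> nat \<Rightarrow> nat \<Rightarrow> real" where
  "arrival d j k = d (0, j) + d (j, k)"

definition recv_time :: "nat \<Rightarrow> (nat \<times> nat \<Rightarrow> real) \<Rightarrow> nat \<Rightarrow> real" where
  "recv_time n d k = Max ((\<lambda>j. arrival d j k) ` others n k)"

definition local_clock :: "(nat \<Rightarrow> real) \<Rightarrow> nat \<Rightarrow> real \<Rightarrow> real" where
  "local_clock c k t = t + c k"

definition T_est :: "real \<Rightarrow> nat \<Rightarrow> (nat \<Rightarrow> real) \<Rightarrow> (nat \<times> nat \<Rightarrow> real) \<Rightarrow> nat \<Rightarrow> real" where
  "T_est l n c d k = (\<Sum>j\<in>others n k. local_clock c k (arrival d j k)) / real n - 2 / l"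

definition pa_delta :: "real \<Rightarrow> nat \<Rightarrow> real" where
  "pa_delta l n = ln (real n) / (l * sqrt (real n))"

text \<open>Time t_k: the earliest t \<ge> recv_time with C_k(t) - T \<ge> Delta + 2 delta (k-1).\<close>
definition action_time :: "real \<Rightarrow> nat \<Rightarrow> real \<Rightarrow> (nat \<Rightarrow> real) \<Rightarrow> (nat \<times> nat \<Rightarrow> real) \<Rightarrow> nat \<Rightarrow> real" where
  "action_time l n \<Delta> c d k =
     max (recv_time n d k)
         (\<Delta> + 2 * pa_delta l n * (real k - 1) + T_est l n c d k - c k)"

definition correct_run :: "real \<Rightarrow> nat \<Rightarrow> real \<Rightarrow> (nat \<Rightarrow> real) \<Rightarrow> (nat \<times> nat \<Rightarrow> real) \<Rightarrow> bool" where
  "correct_run l n \<Delta> c d \<longleftrightarrow>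
     (\<forall>k\<in>{1..n}. action_time l n \<Delta> c d k \<le> action_time l n \<Delta> c d (Suc k))"

definition Psi :: "nat \<Rightarrow> real" where
  "Psi n = max 0 (1
      - (1 - ln (real n) / (2 * sqrt (real n))) ^ (2 * n) * real n powr (1 + sqrt (real n))
      - (1 + ln (real n) / (2 * sqrt (real n))) ^ (2 * n) * real n powr (1 - sqrt (real n)))"

end

theory Submission
  imports Defs "HOL-Combinatorics.Permutations"
begin

text \<open>
  Let \<open>A\<close> be the event that every message takes at most \<open>\<Delta>/2\<close>; its probability is
  \<open>(1 - q)^((n+1)^2)\<close> with \<open>q = exp (- \<lambda>\<Delta>/2)\<close>. Write \<open>S\<^sub>k\<close> for the error of the trigger time
  estimated by worker \<open>k\<close>. On \<open>A\<close> all workers have computed their estimate by time \<open>\<Delta>\<close>, so the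
  run is correct if \<open>S\<^sub>k - S\<^sub>k\<^sub>+\<^sub>1 < 2\<delta>\<close> and \<open>S\<^sub>k\<^sub>+\<^sub>1 > -2\<delta>\<close> for \<open>k = 1, \<dots>, n\<close>.

  Conditioning on \<open>A\<close> truncates the delays, which makes lower deviations of \<open>S\<^sub>k\<close> more likely, so
  independence of \<open>A\<close> and the deviation events cannot be used. However, \<open>S\<^sub>k - S\<^sub>k\<^sub>+\<^sub>1\<close> is a sum of
  symmetric terms on which truncation only lowers the moment generating function, and it has room to
  spare in the Chernoff bound because the trigger delays nearly cancel. For \<open>S\<^sub>k\<^sub>+\<^sub>1\<close> the truncation
  shifts the mean, but if \<open>q < ln n / n\<close> the shift is below \<open>4\<delta>/5\<close> while the admissible
  deviation is \<open>2\<delta>\<close>. Both failure probabilities together stay below \<open>n exp (- (ln n)^2 / 4)\<close>, which is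
  a lower bound of the last term of \<open>\<Psi>(n)\<close>.

  If \<open>q \<ge> ln n / n\<close>, then \<open>(1 - q)^((n+1)^2) \<le> 1 / (2 (n+1)!)\<close>. On the other hand, with probability at
  least \<open>1/2\<close> all differences of the \<open>S\<^sub>k\<close> are below \<open>2\<delta>\<close>. This event is invariant under renaming
  the workers, so together with it the workers finish collecting messages in the order \<open>1, \<dots>, n+1\<close> with
  probability at least \<open>1 / (2 (n+1)!)\<close>, and every such run is correct.

  Finally, \<open>\<Psi>(n) = 0\<close> if \<open>ln n \<le> 4\<close>, which leaves room for crude numerical estimates.
\<close>

section \<open>Message delays\<close>

text \<open>For an exponential delay \<open>X\<close> with parameter \<open>\<lambda>\<close> this is the integral of
  \<open>exp (s \<lambda> X)\<close> over the event \<open>X \<le> m\<close>, where \<open>b = \<lambda> m\<close>.\<close>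

definition trunc_mgf :: "real \<Rightarrow> real \<Rightarrow> real" where
  "trunc_mgf b s = (1 - exp (- ((1 - s) * b))) / (1 - s)"

lemma trunc_mgf_0: "trunc_mgf b 0 = 1 - exp (- b)"
  by (simp add: trunc_mgf_def)

lemma trunc_mgf_pos: "0 < b \<Longrightarrow> s < 1 \<Longrightarrow> 0 < trunc_mgf b s"
  by (simp add: trunc_mgf_def)

lemma trunc_mgf_nonneg: "0 \<le> b \<Longrightarrow> s < 1 \<Longrightarrow> 0 \<le> trunc_mgf b s"
  by (simp add: trunc_mgf_def)

text \<open>Exponential tilting: \<open>exp (s * l * y)\<close> times the density with parameter
  \<open>l\<close> is \<open>1 / (1 - s)\<close> times the density with parameter
  \<open>l * (1 - s)\<close>, whose distribution function is then evaluated at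
  \<open>m\<close>.\<close>

lemma nn_integral_trunc_mgf:
  fixes l m s :: real
  assumes "0 < l" "0 \<le> m" "s < 1"
  shows "(\<integral>\<^sup>+y. ennreal (indicator {..m} y * exp (s * l * y)) \<partial>density lborel (exponential_density l))
    = ennreal (trunc_mgf (l * m) s)"
proof -
  have pos: "0 < l * (1 - s)" using assms by simp
  have "(\<integral>\<^sup>+y. ennreal (indicator {..m} y * exp (s * l * y)) \<partial>density lborel (exponential_density l))
     = (\<integral>\<^sup>+y. ennreal (exponential_density l y) * ennreal (indicator {..m} y * exp (s * l * y)) \<partial>lborel)"
    by (intro nn_integral_density) auto
  also have "\<dots> = (\<integral>\<^sup>+y. ennreal (1 / (1 - s)) *
      (ennreal (exponential_density (l * (1 - s)) y) * indicator {..m} y) \<partial>lborel)"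
  proof (intro nn_integral_cong)
    fix y :: real
    have "exponential_density l y * exp (s * l * y) = 1 / (1 - s) * exponential_density (l * (1 - s)) y"
      using assms by (simp add: exponential_density_def exp_add[symmetric] field_simps)
    then show "ennreal (exponential_density l y) * ennreal (indicator {..m} y * exp (s * l * y))
      = ennreal (1 / (1 - s)) * (ennreal (exponential_density (l * (1 - s)) y) * indicator {..m} y)"
      using assms pos
      by (auto simp: ennreal_mult'[symmetric] exponential_density_nonneg indicator_def ennreal_mult''[symmetric])
  qed
  also have "\<dots> = ennreal (1 / (1 - s)) * emeasure (density lborel (exponential_density (l * (1 - s)))) {..m}"
    by (simp add: nn_integral_cmult emeasure_density)
  also have "\<dots> = ennreal (1 / (1 - s)) * ennreal (erlang_CDF 0 (l * (1 - s)) m)"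
    using assms pos by (simp add: emeasure_erlang_density)
  also have "\<dots> = ennreal (trunc_mgf (l * m) s)"
    using assms by (simp add: ennreal_mult'[symmetric] erlang_CDF_0 trunc_mgf_def algebra_simps diff_divide_distrib)
  finally show ?thesis .
qed

section \<open>The set of messages, split into triggers and redirects grouped by receiver\<close>

lemma msgs_eq: "msgs n = ({0} \<times> workers n) \<union> (\<lambda>(k, j). (j, k)) ` Sigma (workers n) (others n)"
  by (auto simp: msgs_def others_def)

lemma finite_workers [simp]: "finite (workers n)"
  by (simp add: workers_def)

lemma finite_others [simp]: "finite (others n k)"
  by (simp add: others_def)

lemma finite_msgs [simp]: "finite (msgs n)"
  by (simp add: msgs_eq)

lemma card_others: "k \<in> workers n \<Longrightarrow> card (others n k) = n"
  by (simp add: others_def workers_def)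

lemma msgs_trigger [simp]: "k \<in> workers n \<Longrightarrow> (0, k) \<in> msgs n"
  by (simp add: msgs_def)

lemma msgs_redirect [simp]: "k \<in> workers n \<Longrightarrow> j \<in> others n k \<Longrightarrow> (j, k) \<in> msgs n"
  by (auto simp: msgs_def others_def)

lemma others_in_workers: "j \<in> others n k \<Longrightarrow> j \<in> workers n"
  by (simp add: others_def)

text \<open>Proved for an arbitrary commutative monoid so that sums and products over messages both
  follow. The receiver is the outer index because the Chernoff coefficients of redirects depend only
  on it.\<close>

lemma comm_F_msgs:
  assumes "comm_monoid_set f z"
  shows "comm_monoid_set.F f z g (msgs n) =
    f (comm_monoid_set.F f z (\<lambda>k. g (0, k)) (workers n))
      (comm_monoid_set.F f z (\<lambda>k. comm_monoid_set.F f z (\<lambda>j. g (j, k)) (others n k)) (workers n))"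
proof -
  interpret comm_monoid_set f z by fact
  have inj1: "inj_on (\<lambda>k. (0::nat, k)) (workers n)" by (auto simp: inj_on_def)
  have e1: "{0} \<times> workers n = (\<lambda>k. (0, k)) ` workers n" by auto
  have inj2: "inj_on (\<lambda>(k, j). (j, k)) (Sigma (workers n) (others n))" by (auto simp: inj_on_def)
  have "F g (msgs n) = f (F g ({0} \<times> workers n)) (F g ((\<lambda>(k, j). (j, k)) ` Sigma (workers n) (others n)))"
    unfolding msgs_eq by (rule union_disjoint) (auto simp: others_def workers_def)
  also have "F g ({0} \<times> workers n) = F (\<lambda>k. g (0, k)) (workers n)"
    unfolding e1 using inj1 by (subst reindex) (auto simp: comp_def)
  also have "F g ((\<lambda>(k, j). (j, k)) ` Sigma (workers n) (others n)) =
      F (\<lambda>k. F (\<lambda>j. g (j, k)) (others n k)) (workers n)"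
    using inj2 by (subst reindex) (auto simp: comp_def case_prod_beta Sigma)
  finally show ?thesis .
qed

lemma sum_msgs:
  fixes g :: "nat \<times> nat \<Rightarrow> 'a::comm_monoid_add"
  shows "(\<Sum>i\<in>msgs n. g i) = (\<Sum>k\<in>workers n. g (0, k)) + (\<Sum>k\<in>workers n. \<Sum>j\<in>others n k. g (j, k))"
  using comm_F_msgs[OF sum.comm_monoid_set_axioms, of g n] by (simp add: sum_def)

lemma prod_msgs:
  fixes g :: "nat \<times> nat \<Rightarrow> 'a::comm_monoid_mult"
  shows "(\<Prod>i\<in>msgs n. g i) = (\<Prod>k\<in>workers n. g (0, k)) * (\<Prod>k\<in>workers n. \<Prod>j\<in>others n k. g (j, k))"
  using comm_F_msgs[OF prod.comm_monoid_set_axioms, of g n] by (simp add: prod_def)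

lemma card_msgs: "card (msgs n) = (n + 1)\<^sup>2"
proof -
  have "card (msgs n) = card (workers n) + (\<Sum>k\<in>workers n. card (others n k))"
    using sum_msgs[of "\<lambda>_. 1::nat" n] by simp
  also have "\<dots> = card (workers n) + (\<Sum>k\<in>workers n. n)"
    by (simp add: card_others)
  finally show ?thesis by (simp add: workers_def power2_eq_square)
qed

section \<open>Renaming of the workers\<close>

definition relabel :: "nat \<Rightarrow> (nat \<Rightarrow> nat) \<Rightarrow> (nat \<times> nat \<Rightarrow> real) \<Rightarrow> nat \<times> nat \<Rightarrow> real" where
  "relabel n p d = (\<lambda>i\<in>msgs n. d (map_prod p p i))"

lemma permutes_workers_0: "p permutes workers n \<Longrightarrow> p 0 = 0"
  using permutes_not_in[of p "workers n" 0] by (simp add: workers_def)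

lemma map_prod_in_msgs:
  assumes p: "p permutes workers n" and i: "i \<in> msgs n"
  shows "map_prod p p i \<in> msgs n"
  using i permutes_in_image[OF p] permutes_inj[OF p] permutes_workers_0[OF p]
  by (auto simp: msgs_def inj_eq)

section \<open>The product space of delays: truncation, Chernoff bound and symmetry\<close>

context
  fixes l :: real and n :: nat
  assumes l_pos: "0 < l"
begin

lemma prob_space_delay: "prob_space (delay_space l n)"
  unfolding delay_space_def by (intro prob_space_PiM prob_space_exponential_density l_pos)

lemma measurable_delay [measurable]:
  "i \<in> msgs n \<Longrightarrow> (\<lambda>d. d i) \<in> borel_measurable (delay_space l n)"
  unfolding delay_space_def by measurable

lemma nn_integral_prod_trunc_mgf:
  assumes "0 \<le> m" "\<And>i. i \<in> msgs n \<Longrightarrow> \<theta> i < 1"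
  shows "(\<integral>\<^sup>+d. (\<Prod>i\<in>msgs n. ennreal (indicator {..m} (d i) * exp (\<theta> i * l * d i))) \<partial>delay_space l n)
    = ennreal (\<Prod>i\<in>msgs n. trunc_mgf (l * m) (\<theta> i))"
proof -
  let ?E = "\<lambda>_::nat \<times> nat. density lborel (exponential_density l)"
  interpret product_sigma_finite ?E
    unfolding product_sigma_finite_def
    using prob_space_imp_sigma_finite[OF prob_space_exponential_density[OF l_pos]] by simp
  have "(\<integral>\<^sup>+d. (\<Prod>i\<in>msgs n. ennreal (indicator {..m} (d i) * exp (\<theta> i * l * d i))) \<partial>delay_space l n)
     = (\<Prod>i\<in>msgs n. \<integral>\<^sup>+y. ennreal (indicator {..m} y * exp (\<theta> i * l * y)) \<partial>?E i)"
    unfolding delay_space_def by (intro product_nn_integral_prod) auto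
  also have "\<dots> = (\<Prod>i\<in>msgs n. ennreal (trunc_mgf (l * m) (\<theta> i)))"
    using assms l_pos by (intro prod.cong refl nn_integral_trunc_mgf) auto
  also have "\<dots> = ennreal (\<Prod>i\<in>msgs n. trunc_mgf (l * m) (\<theta> i))"
    using assms l_pos by (intro prod_ennreal trunc_mgf_nonneg) auto
  finally show ?thesis .
qed

lemma measure_all_le:
  assumes "0 \<le> m"
  shows "measure (delay_space l n) {d \<in> space (delay_space l n). \<forall>i\<in>msgs n. d i \<le> m}
    = (1 - exp (- (l * m))) ^ (n + 1)\<^sup>2"
proof -
  interpret prob_space "delay_space l n" by (rule prob_space_delay)
  let ?A = "{d \<in> space (delay_space l n). \<forall>i\<in>msgs n. d i \<le> m}"
  have [measurable]: "?A \<in> sets (delay_space l n)" by measurable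
  have "emeasure (delay_space l n) ?A = (\<integral>\<^sup>+d. indicator ?A d \<partial>delay_space l n)"
    by simp
  \<comment> \<open>Tilt 0 turns the plain product of indicators into an instance of
    \<open>nn_integral_prod_trunc_mgf\<close>.\<close>
  also have "\<dots> = (\<integral>\<^sup>+d. (\<Prod>i\<in>msgs n. ennreal (indicator {..m} (d i) * exp (0 * l * d i))) \<partial>delay_space l n)"
  proof (intro nn_integral_cong)
    fix d assume "d \<in> space (delay_space l n)"
    then show "indicator ?A d = (\<Prod>i\<in>msgs n. ennreal (indicator {..m} (d i) * exp (0 * l * d i)))"
      by (cases "\<forall>i\<in>msgs n. d i \<le> m") (auto simp: indicator_def)
  qed
  also have "\<dots> = ennreal (\<Prod>i\<in>msgs n. trunc_mgf (l * m) 0)"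
    using assms by (intro nn_integral_prod_trunc_mgf) auto
  finally show ?thesis
    using assms l_pos by (simp add: trunc_mgf_0 card_msgs emeasure_eq_measure)
qed

text \<open>Markov's inequality for the exponential of the linear form. The truncation event is a
  product of indicators, one per message, so it goes into the same product integral and no
  conditioning is required.\<close>

lemma chernoff_all_le:
  assumes "0 \<le> m" "\<And>i. i \<in> msgs n \<Longrightarrow> \<theta> i < 1"
  shows "measure (delay_space l n) {d \<in> space (delay_space l n).
      (\<forall>i\<in>msgs n. d i \<le> m) \<and> t \<le> (\<Sum>i\<in>msgs n. \<theta> i * l * d i)}
    \<le> exp (- t) * (\<Prod>i\<in>msgs n. trunc_mgf (l * m) (\<theta> i))"
proof -
  interpret prob_space "delay_space l n" by (rule prob_space_delay)
  let ?A = "{d \<in> space (delay_space l n). (\<forall>i\<in>msgs n. d i \<le> m) \<and> t \<le> (\<Sum>i\<in>msgs n. \<theta> i * l * d i)}"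
  let ?P = "\<lambda>d. \<Prod>i\<in>msgs n. ennreal (indicator {..m} (d i) * exp (\<theta> i * l * d i))"
  have [measurable]: "?A \<in> sets (delay_space l n)" by measurable
  have "emeasure (delay_space l n) ?A = (\<integral>\<^sup>+d. indicator ?A d \<partial>delay_space l n)"
    by simp
  also have "\<dots> \<le> (\<integral>\<^sup>+d. ennreal (exp (- t)) * ?P d \<partial>delay_space l n)"
  proof (intro nn_integral_mono)
    fix d
    show "indicator ?A d \<le> ennreal (exp (- t)) * ?P d"
    proof (cases "d \<in> ?A")
      case True
      then have "?P d = (\<Prod>i\<in>msgs n. ennreal (exp (\<theta> i * l * d i)))"
        by (intro prod.cong) auto
      also have "\<dots> = ennreal (exp (\<Sum>i\<in>msgs n. \<theta> i * l * d i))"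
        by (simp add: prod_ennreal exp_sum)
      finally have P: "?P d = ennreal (exp (\<Sum>i\<in>msgs n. \<theta> i * l * d i))" .
      have "1 \<le> exp (- t) * exp (\<Sum>i\<in>msgs n. \<theta> i * l * d i)"
        using True by (simp add: exp_add[symmetric])
      then have "1 \<le> ennreal (exp (- t) * exp (\<Sum>i\<in>msgs n. \<theta> i * l * d i))"
        using ennreal_leI by fastforce
      then show ?thesis using True P by (simp add: ennreal_mult')
    qed simp
  qed
  also have "\<dots> = ennreal (exp (- t)) * (\<integral>\<^sup>+d. ?P d \<partial>delay_space l n)"
    by (intro nn_integral_cmult) measurable
  also have "\<dots> = ennreal (exp (- t) * (\<Prod>i\<in>msgs n. trunc_mgf (l * m) (\<theta> i)))"
    using assms by (subst nn_integral_prod_trunc_mgf) (auto simp: ennreal_mult')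
  finally have "ennreal (prob ?A) \<le> ennreal (exp (- t) * (\<Prod>i\<in>msgs n. trunc_mgf (l * m) (\<theta> i)))"
    by (simp only: emeasure_eq_measure)
  moreover have "0 \<le> (\<Prod>i\<in>msgs n. trunc_mgf (l * m) (\<theta> i))"
    using assms l_pos by (intro prod_nonneg trunc_mgf_nonneg) auto
  ultimately show ?thesis
    by (subst (asm) ennreal_le_iff) auto
qed

context
  fixes p :: "nat \<Rightarrow> nat"
  assumes p: "p permutes workers n"
begin

lemma measurable_relabel: "relabel n p \<in> delay_space l n \<rightarrow>\<^sub>M delay_space l n"
  unfolding delay_space_def relabel_def
  by (intro measurable_restrict measurable_component_singleton map_prod_in_msgs p)

text \<open>The delays are independent and identically distributed and \<open>map_prod p p\<close>
  is injective on \<open>msgs n\<close>, so reindexing preserves the product measure.\<close>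

lemma distr_relabel: "distr (delay_space l n) (delay_space l n) (relabel n p) = delay_space l n"
proof -
  have "inj_on (map_prod p p) (msgs n)"
    using permutes_inj[OF p] by (auto simp: inj_on_def dest: injD)
  then show ?thesis
    unfolding delay_space_def relabel_def
    using distr_PiM_reindex[of "msgs n" "\<lambda>_. density lborel (exponential_density l)" "map_prod p p" "msgs n"]
      prob_space_exponential_density[OF l_pos] map_prod_in_msgs[OF p] by (simp add: Pi_iff)
qed

lemma measure_relabel:
  assumes P [measurable]: "Measurable.pred (delay_space l n) P"
  shows "measure (delay_space l n) {d \<in> space (delay_space l n). P (relabel n p d)}
    = measure (delay_space l n) {d \<in> space (delay_space l n). P d}"
proof -
  note measurable_relabel [measurable]
  have "measure (delay_space l n) {d \<in> space (delay_space l n). P d}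
     = measure (distr (delay_space l n) (delay_space l n) (relabel n p)) {d \<in> space (delay_space l n). P d}"
    by (simp only: distr_relabel)
  also have "\<dots> = measure (delay_space l n) (relabel n p -` {d \<in> space (delay_space l n). P d} \<inter> space (delay_space l n))"
    by (intro measure_distr) measurable
  also have "relabel n p -` {d \<in> space (delay_space l n). P d} \<inter> space (delay_space l n)
     = {d \<in> space (delay_space l n). P (relabel n p d)}"
    using measurable_space[OF measurable_relabel] by auto
  finally show ?thesis by simp
qed

end

end

section \<open>Estimates\<close>

text \<open>Apart from constants the numerators multiply to
  \<open>- 2 * exp (- b) * cosh (x * b)\<close>, and \<open>cosh\<close> is at least 1. The factor
  \<open>1 / (1 - x^2)\<close> is the value without truncation, so truncation only helps for
  opposite tilts.\<close>

lemma trunc_mgf_mult_uminus_le: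
  assumes "0 \<le> b" "\<bar>x\<bar> < 1"
  shows "trunc_mgf b x * trunc_mgf b (- x) \<le> (trunc_mgf b 0)\<^sup>2 * (1 / (1 - x\<^sup>2))"
proof -
  have "0 \<le> (exp (x * b / 2) - exp (- (x * b / 2)))\<^sup>2" by simp
  also have "\<dots> = exp (x * b) + exp (- (x * b)) - 2"
    by (simp add: power2_diff exp_double[symmetric] exp_minus_inverse)
  finally have "exp (- b) * 2 \<le> exp (- b) * (exp (x * b) + exp (- (x * b)))"
    by (intro mult_left_mono) auto
  moreover have "(1 - exp (- ((1 - x) * b))) * (1 - exp (- ((1 - - x) * b)))
    = 1 - exp (- b) * (exp (x * b) + exp (- (x * b))) + (exp (- b))\<^sup>2"
    by (simp add: algebra_simps exp_add[symmetric] power2_eq_square)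
  ultimately have "(1 - exp (- ((1 - x) * b))) * (1 - exp (- ((1 - - x) * b))) \<le> (1 - exp (- b))\<^sup>2"
    by (simp add: power2_diff)
  moreover have "(1 - x) * (1 - - x) = 1 - x\<^sup>2" by (simp add: power2_eq_square algebra_simps)
  moreover have "x\<^sup>2 < 1" using assms by (simp add: abs_square_less_1)
  ultimately show ?thesis
    unfolding trunc_mgf_def by (simp add: divide_right_mono)
qed

text \<open>Serves twice: it bounds \<open>1 / (1 + x)\<close>, the untruncated value at tilt
  \<open>- x\<close>, from above, and the last term of \<open>Psi\<close> from below.\<close>

lemma exp_minus_half_square_le:
  fixes x :: real
  assumes "0 \<le> x"
  shows "exp (x - x\<^sup>2 / 2) \<le> 1 + x"
proof -
  let ?f = "\<lambda>x::real. ln (1 + x) - x + x\<^sup>2 / 2"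
  have "?f 0 \<le> ?f x"
  proof (rule DERIV_nonneg_imp_nondecreasing[OF assms])
    fix y :: real assume y: "0 \<le> y" "y \<le> x"
    have "(?f has_real_derivative 1 / (1 + y) - 1 + y) (at y)"
      using y by (auto intro!: derivative_eq_intros)
    moreover have "1 / (1 + y) - 1 + y = y\<^sup>2 / (1 + y)"
      using y by (simp add: field_simps power2_eq_square)
    ultimately show "\<exists>z. (?f has_real_derivative z) (at y) \<and> 0 \<le> z"
      using y by (intro exI[of _ "y\<^sup>2 / (1 + y)"]) auto
  qed
  then have "x - x\<^sup>2 / 2 \<le> ln (1 + x)" by simp
  then show ?thesis using assms by (subst (asm) ln_ge_iff) auto
qed

text \<open>The part \<open>- x + x^2 / 2\<close> comes from \<open>1 / (1 + x)\<close>. The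
  fraction multiplying \<open>x\<close> is the amount by which truncation at \<open>b\<close> lowers
  the mean of a standard exponential variable.\<close>

lemma trunc_mgf_uminus_le:
  assumes b: "0 < b" and x: "0 \<le> x"
  shows "trunc_mgf b (- x)
    \<le> trunc_mgf b 0 * exp (- x + x\<^sup>2 / 2 + x * (b * exp (- b) / (1 - exp (- b))))"
proof -
  define q where "q = exp (- b)"
  have q: "0 < q" "q < 1" using b by (auto simp: q_def)
  define y where "y = x * (b * q / (1 - q))"
  have "1 - exp (- ((1 - - x) * b)) = 1 - q * exp (- (x * b))"
    by (simp add: q_def algebra_simps exp_add[symmetric])
  also have "\<dots> \<le> 1 - q * (1 - x * b)"
    using q exp_ge_add_one_self[of "- (x * b)"] by simp
  also have "\<dots> = (1 - q) * (1 + y)"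
    using q by (simp add: y_def field_simps)
  also have "\<dots> \<le> (1 - q) * exp y"
    using q exp_ge_add_one_self[of y] by (intro mult_left_mono) auto
  finally have num: "1 - exp (- ((1 - - x) * b)) \<le> (1 - q) * exp y" .
  have den: "1 / (1 + x) \<le> exp (- x + x\<^sup>2 / 2)"
  proof -
    have "1 / (1 + x) \<le> 1 / exp (x - x\<^sup>2 / 2)"
      using exp_minus_half_square_le[OF x] x by (intro divide_left_mono) auto
    also have "\<dots> = exp (- (x - x\<^sup>2 / 2))" by (simp only: exp_minus inverse_eq_divide)
    finally show ?thesis by simp
  qed
  have "trunc_mgf b (- x) = (1 - exp (- ((1 - - x) * b))) * (1 / (1 + x))"
    unfolding trunc_mgf_def by simp
  also have "\<dots> \<le> (1 - q) * exp y * exp (- x + x\<^sup>2 / 2)"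
    using x q by (intro mult_mono num den) auto
  also have "\<dots> = (1 - q) * exp (- x + x\<^sup>2 / 2 + y)"
    by (simp only: exp_add mult_ac)
  finally show ?thesis unfolding trunc_mgf_0 y_def q_def .
qed

text \<open>With \<open>x = L / (2 * r)\<close> one has \<open>2 * n * x = r * L\<close> and
  \<open>n * x^2 = L^2 / 4\<close>, so in the last term of \<open>Psi\<close> the factors
  \<open>exp (r * L)\<close> and \<open>exp (- r * L)\<close> cancel.\<close>

lemma Psi_le:
  assumes "1 \<le> n"
  shows "Psi n \<le> max 0 (1 - real n * exp (- ((ln n)\<^sup>2 / 4)))"
proof -
  define L r x where "L = ln (real n)" and "r = sqrt (real n)" and "x = L / (2 * r)"
  have r: "0 < r" "real n = r\<^sup>2" using assms by (auto simp: r_def)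
  have x0: "0 \<le> x" using assms r by (simp add: x_def L_def)
  have powr: "real n powr (1 + t) = real n * exp (t * L)" for t
    using assms by (simp add: powr_def L_def algebra_simps exp_add)
  have "exp (r * L - L\<^sup>2 / 4) = exp (x - x\<^sup>2 / 2) ^ (2 * n)"
    using r by (simp add: x_def exp_of_nat_mult[symmetric] field_simps power2_eq_square)
  also have "\<dots> \<le> (1 + x) ^ (2 * n)"
    by (intro power_mono exp_minus_half_square_le x0) auto
  finally have "exp (r * L - L\<^sup>2 / 4) * (real n * exp (- r * L))
      \<le> (1 + x) ^ (2 * n) * (real n * exp (- r * L))"
    by (rule mult_right_mono) simp
  moreover have "exp (r * L - L\<^sup>2 / 4) * (real n * exp (- r * L)) = real n * exp (- (L\<^sup>2 / 4))"
    by (simp add: mult.left_commute exp_add[symmetric])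
  moreover have "real n powr (1 - r) = real n * exp (- r * L)"
    using powr[of "- r"] by simp
  ultimately have "real n * exp (- (L\<^sup>2 / 4)) \<le> (1 + x) ^ (2 * n) * real n powr (1 - r)"
    by (simp only:)
  moreover have "0 \<le> (1 - x) ^ (2 * n) * real n powr (1 + r)"
    by (simp add: power_mult)
  ultimately have "1 - (1 - x) ^ (2 * n) * real n powr (1 + r) - (1 + x) ^ (2 * n) * real n powr (1 - r)
      \<le> 1 - real n * exp (- (L\<^sup>2 / 4))"
    by linarith
  then show ?thesis
    unfolding Psi_def x_def r_def L_def by (intro max.mono) auto
qed

text \<open>The threshold 4 is the root of \<open>L - L^2 / 4\<close>, the exponent of the lower
  bound for the subtracted term.\<close>

lemma Psi_eq_0:
  assumes "1 \<le> n" "ln n \<le> 4"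
  shows "Psi n = 0"
proof -
  define L where "L = ln (real n)"
  have L: "0 \<le> L" "L \<le> 4" "real n = exp L" using assms by (auto simp: L_def)
  have "L * L \<le> 4 * L" using L by (intro mult_right_mono) auto
  then have "1 \<le> exp (L + - (L\<^sup>2 / 4))" by (simp add: power2_eq_square)
  also have "\<dots> = real n * exp (- ((ln n)\<^sup>2 / 4))" by (simp only: exp_add L(3)[symmetric] L_def[symmetric])
  finally have "Psi n \<le> 0" using Psi_le[OF assms(1)] by simp
  then show ?thesis by (simp add: Psi_def)
qed

section \<open>Numerical estimates for ln n > 4\<close>

context
  fixes n :: nat and L r x :: real
  assumes L_def: "L = ln (real n)" and r_def: "r = sqrt (real n)" and x_def: "x = L / (2 * r)"
    and L_gt: "4 < L"
begin

lemma n_pos: "0 < n"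
  using L_gt by (cases "n = 0") (auto simp: L_def)

lemma n_eq: "real n = exp L" "real n = r\<^sup>2" "r = exp (L / 2)"
proof -
  show "real n = exp L" "real n = r\<^sup>2" using n_pos by (auto simp: L_def r_def)
  then have "r\<^sup>2 = (exp (L / 2))\<^sup>2" by (simp add: exp_double[symmetric])
  then show "r = exp (L / 2)" by (simp add: r_def)
qed

text \<open>Tangent to \<open>exp (L / 2)\<close> at \<open>L = 4\<close>, with \<open>exp 2\<close>
  rounded down to 73/10.\<close>

lemma r_ge: "r \<ge> (73/20) * (L - 2)"
proof -
  have "(73/10) \<le> exp (2::real)"
  proof -
    obtain t where "exp (2::real) = (\<Sum>m<7. 2 ^ m / fact m) + exp t / fact 7 * 2 ^ 7"
      using Maclaurin_exp_le[of 2 7] by blast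
    moreover have "0 \<le> exp t / fact 7 * (2::real) ^ 7" by simp
    moreover have "(\<Sum>m<7. 2 ^ m / fact m) \<ge> ((73/10)::real)" by (simp add: eval_nat_numeral)
    ultimately show ?thesis by linarith
  qed
  then have "(73/10) * (1 + (L - 4) / 2) \<le> exp 2 * exp ((L - 4) / 2)"
    using L_gt by (intro mult_mono exp_ge_add_one_self) auto
  also have "\<dots> = r" by (simp add: n_eq(3) exp_add[symmetric] add_divide_distrib diff_divide_distrib)
  finally show ?thesis by (simp add: field_simps)
qed

lemma r_pos: "0 < r" using r_ge L_gt by simp

lemma x_bounds: "0 < x" "x \<le> (7/25)"
proof -
  show "0 < x" using r_pos L_gt by (simp add: x_def)
  have "L \<le> (14/25) * r" using r_ge L_gt by simp
  then show "x \<le> (7/25)" using r_pos by (simp add: x_def field_simps)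
qed

text \<open>Since \<open>n * x^2 = L^2 / 4\<close>, the power is roughly
  \<open>exp (L^2 / 4)\<close>; the exponent is rounded up to \<open>(3/10) * L^2\<close>.\<close>

lemma spread_bound: "exp (- L\<^sup>2) * (1 / (1 - x\<^sup>2)) ^ (n + 1) \<le> exp (- ((7/10) * L\<^sup>2))"
proof -
  have x2: "x\<^sup>2 \<le> (7/25)\<^sup>2" using x_bounds by (intro power_mono) auto
  then have d: "0 < 1 - x\<^sup>2" by (simp add: power2_eq_square)
  have "1 / (1 - x\<^sup>2) = 1 + x\<^sup>2 / (1 - x\<^sup>2)" using d by (simp add: field_simps)
  also have "\<dots> \<le> exp (x\<^sup>2 / (1 - x\<^sup>2))" by (rule exp_ge_add_one_self)
  finally have "(1 / (1 - x\<^sup>2)) ^ (n + 1) \<le> exp (x\<^sup>2 / (1 - x\<^sup>2)) ^ (n + 1)"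
    using d by (intro power_mono) auto
  also have "\<dots> = exp (real (n + 1) * (x\<^sup>2 / (1 - x\<^sup>2)))" by (simp only: exp_of_nat_mult)
  also have "\<dots> \<le> exp ((3/10) * L\<^sup>2)"
  proof -
    have "53 \<le> r\<^sup>2" using power_mono[of "73/10" r 2] r_ge L_gt by (simp add: power2_eq_square)
    then have "real n \<ge> 53" unfolding n_eq(2) .
    \<comment> \<open>The constant in front of \<open>real n\<close> exceeds 1.1, so
      \<open>n \<ge> 53\<close> absorbs the \<open>+ 1\<close>.\<close>
    then have "real (n + 1) \<le> 4 * (3/10) * (1 - (7/25)\<^sup>2) * real n" by (simp add: power2_eq_square)
    also have "\<dots> \<le> 4 * (3/10) * (1 - x\<^sup>2) * real n" using x2 by (intro mult_right_mono mult_left_mono) auto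
    finally have "real (n + 1) * x\<^sup>2 \<le> 4 * (3/10) * (1 - x\<^sup>2) * real n * x\<^sup>2" by (intro mult_right_mono) auto
    also have "\<dots> = 4 * (3/10) * (1 - x\<^sup>2) * (real n * x\<^sup>2)" by (simp only: mult.assoc)
    also have "real n * x\<^sup>2 = L\<^sup>2 / 4"
      using r_pos by (simp add: n_eq(2) x_def power_divide power_mult_distrib)
    finally have "real (n + 1) * x\<^sup>2 \<le> (3/10) * L\<^sup>2 * (1 - x\<^sup>2)" by (simp add: algebra_simps)
    then show ?thesis using d by (simp add: pos_divide_le_eq)
  qed
  finally have "exp (- L\<^sup>2) * (1 / (1 - x\<^sup>2)) ^ (n + 1) \<le> exp (- L\<^sup>2) * exp ((3/10) * L\<^sup>2)"
    by (intro mult_left_mono) auto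
  then show ?thesis by (simp add: exp_add[symmetric])
qed

text \<open>Here \<open>y\<close> is the mean shift caused by truncation. The terms linear in
  \<open>x\<close> cancel, and the exponent is at most \<open>- 1 + 1/4 + 2/5 = - 7/20\<close> times
  \<open>L^2\<close>.\<close>

lemma late_bound:
  assumes "y \<le> (2/5) * L / r"
  shows "exp (- L\<^sup>2 + 2 * real n * x) * exp (- x + x\<^sup>2 / 2 + x * y) ^ (2 * n) \<le> exp (- ((7/20) * L\<^sup>2))"
proof -
  have "x * y \<le> x * ((2/5) * L / r)" using x_bounds assms by (intro mult_left_mono) auto
  then have "2 * real n * (x * y) \<le> 2 * real n * (x * ((2/5) * L / r))"
    by (rule mult_left_mono) auto
  also have "\<dots> = (2/5) * L\<^sup>2" using r_pos by (simp add: n_eq(2) x_def power2_eq_square)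
  finally have 1: "2 * real n * (x * y) \<le> (2/5) * L\<^sup>2" .
  have 2: "real n * x\<^sup>2 = L\<^sup>2 / 4"
    using r_pos by (simp add: n_eq(2) x_def power_divide power_mult_distrib)
  have "exp (- L\<^sup>2 + 2 * real n * x) * exp (- x + x\<^sup>2 / 2 + x * y) ^ (2 * n)
    = exp (- L\<^sup>2 + real n * x\<^sup>2 + 2 * real n * (x * y))"
    by (simp add: exp_of_nat_mult[symmetric] exp_add[symmetric] algebra_simps)
  also have "\<dots> \<le> exp (- ((7/20) * L\<^sup>2))"
    unfolding exp_le_cancel_iff using 1 2 by linarith
  finally show ?thesis .
qed

text \<open>With \<open>q = exp (- b)\<close> the numerator is \<open>- q * ln q\<close>, which
  increases for small \<open>q\<close>; so \<open>q\<close> may be replaced by the larger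
  \<open>p = L / n\<close>, where \<open>- ln p = L - ln L\<close>.\<close>

lemma truncation_shift_bound:
  assumes "0 < b" "exp (- b) < L / real n"
  shows "b * exp (- b) / (1 - exp (- b)) \<le> (2/5) * L / r"
proof -
  define q p where "q = exp (- b)" and "p = L / real n"
  have q: "0 < q" "q < p" "b = - ln q" using assms by (auto simp: q_def p_def)
  have p: "0 < p" "ln p = ln L - L"
    using n_pos L_gt unfolding p_def by (auto simp: ln_div L_def[symmetric])
  have lnL: "4 / 3 \<le> ln L"
  proof -
    have "4 / 3 \<le> 2 * ln (2::real)" using ln2_ge_two_thirds by simp
    also have "\<dots> = ln (2 ^ 2)" by (subst ln_realpow) auto
    also have "\<dots> \<le> ln L" using L_gt by (subst ln_le_cancel_iff) auto
    finally show ?thesis .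
  qed
  have "ln L \<le> L - 1" using L_gt by (intro ln_le_minus_one) auto
  then have lnp: "1 \<le> - ln p" using p by simp
  have rL: "L \<le> (14/25) * r" using r_ge L_gt by simp
  have p_eq: "p = L / r / r" by (simp add: p_def n_eq(2) power2_eq_square)
  have Lr: "L / r \<le> (14/25)" using rL r_pos by (simp add: field_simps)
  have "p * r \<le> (14/25)" using Lr r_pos by (simp add: p_eq)
  then have "p \<le> (14/25) / r" using r_pos by (simp add: field_simps)
  also have "\<dots> \<le> (14/25) / (73/10)" using r_ge L_gt by (intro divide_left_mono) auto
  finally have p1: "p < 1" by simp
  \<comment> \<open>This bound on \<open>ln\<close> replaces the monotonicity argument: it yields a
    bound linear in \<open>q\<close> with slope \<open>- ln p - 1 \<ge> 0\<close>.\<close>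
  have "ln (p / q) \<le> p / q - 1" using p q by (intro ln_le_minus_one) auto
  then have "b \<le> - ln p + (p / q - 1)" using p q by (simp add: ln_div)
  then have "q * b \<le> q * (- ln p + (p / q - 1))" using q by (intro mult_left_mono) auto
  also have "\<dots> = q * (- ln p - 1) + p" using q by (simp add: algebra_simps)
  also have "\<dots> \<le> p * (- ln p - 1) + p"
    using q lnp by (intro add_right_mono mult_right_mono) auto
  also have "\<dots> = p * (L - ln L)" unfolding p(2) by (simp add: algebra_simps)
  \<comment> \<open>The subtracted \<open>(2/5) * (L / r)\<close> is there to produce the factor
    \<open>1 - p\<close> below, which pays for the denominator \<open>1 - q\<close>.\<close>
  also have "\<dots> \<le> p * ((2/5) * r - (2/5) * (L / r))"
  proof (intro mult_left_mono)
    have "z \<le> 14/25 \<Longrightarrow> L - ln L \<le> (2/5) * r - (2/5) * z" for z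
      using lnL r_ge L_gt by (simp add: field_simps)
    then show "L - ln L \<le> (2/5) * r - (2/5) * (L / r)" using Lr .
  qed (use p in simp)
  also have "\<dots> = (2/5) * L / r * (1 - p)"
  proof -
    have pr: "p * r = L / r" using r_pos by (simp add: p_eq)
    have "p * ((2/5) * r - (2/5) * (L / r)) = (2/5) * (p * r) - (2/5) * p * (L / r)"
      by (simp add: algebra_simps)
    then show ?thesis unfolding pr by (simp add: algebra_simps diff_divide_distrib)
  qed
  also have "\<dots> \<le> (2/5) * L / r * (1 - q)"
    using q r_pos L_gt by (intro mult_left_mono) auto
  finally have "b * q \<le> (2/5) * L / r * (1 - q)" by (simp add: mult.commute)
  moreover have "0 < 1 - q" using q p1 by simp
  ultimately show ?thesis unfolding q_def[symmetric] by (simp only: pos_divide_le_eq)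
qed

lemma L_square_ge: "16 \<le> L\<^sup>2"
  using power_mono[of 4 L 2] L_gt by simp

text \<open>After division by \<open>exp (- (L^2 / 4))\<close> both remaining exponents are at most
  -1, because \<open>L^2 \<ge> 16\<close>; so each summand is at most 1/2.\<close>

lemma union_bound_adjacent:
  "exp (- ((7/10) * L\<^sup>2)) + exp (- ((7/20) * L\<^sup>2)) \<le> exp (- (L\<^sup>2 / 4))"
proof -
  have half: "exp (- t) \<le> 1 / 2" if "1 \<le> t" for t :: real
  proof -
    have "2 \<le> exp t" using exp_ge_add_one_self[of t] that by linarith
    then show ?thesis by (simp add: exp_minus field_simps)
  qed
  have "exp (- ((9/20) * L\<^sup>2)) + exp (- ((1/10) * L\<^sup>2)) \<le> 1"
    using half[of "(9/20) * L\<^sup>2"] half[of "(1/10) * L\<^sup>2"] L_square_ge by simp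
  then have "exp (- (L\<^sup>2 / 4)) * (exp (- ((9/20) * L\<^sup>2)) + exp (- ((1/10) * L\<^sup>2))) \<le> exp (- (L\<^sup>2 / 4)) * 1"
    by (intro mult_left_mono) auto
  then show ?thesis by (simp add: distrib_left exp_add[symmetric])
qed

text \<open>There are \<open>(n + 1) * n \<le> 2 * exp (2 * L)\<close> ordered pairs of distinct
  workers, and \<open>(7/10) * L^2 - 2 * L\<close> is at least 3.\<close>

lemma union_bound_all_pairs: "real (n + 1) * real n * exp (- ((7/10) * L\<^sup>2)) \<le> 1 / 4"
proof -
  have "8 \<le> exp (3::real)"
    using exp_lower_Taylor_quadratic[of "3::real"] by simp
  moreover have "exp 3 \<le> exp ((7/10) * L\<^sup>2 - 2 * L)"
  proof -
    have "4 * L \<le> L * L" using L_gt by (intro mult_right_mono) auto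
    then show ?thesis using L_gt unfolding exp_le_cancel_iff power2_eq_square by linarith
  qed
  ultimately have *: "8 \<le> exp ((7/10) * L\<^sup>2 - 2 * L)" by (rule order_trans)
  have "real (n + 1) * real n \<le> 2 * real n * real n"
    using n_pos by (intro mult_right_mono) auto
  also have "\<dots> = 2 * exp (2 * L)" by (simp add: n_eq(1) exp_double power2_eq_square)
  finally have "real (n + 1) * real n * exp (- ((7/10) * L\<^sup>2)) \<le> 2 * exp (2 * L) * exp (- ((7/10) * L\<^sup>2))"
    by (intro mult_right_mono) auto
  also have "\<dots> = 2 / exp ((7/10) * L\<^sup>2 - 2 * L)"
    unfolding exp_diff exp_minus by (simp add: inverse_eq_divide)
  also have "\<dots> \<le> 2 / 8" using * by (intro divide_left_mono) auto
  finally show ?thesis by simp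
qed

text \<open>Both sides are compared with \<open>1 / (n + 1) ^ (n + 1)\<close>: on the left since
  \<open>(n + 1) * q \<ge> ln (n + 1)\<close>, on the right since \<open>fact n \<le> n ^ n\<close>
  and \<open>(1 + 1/n) ^ n \<ge> 2\<close>.\<close>

lemma all_small_prob_le_fact:
  assumes "q \<ge> L / real n" "q \<le> 1"
  shows "(1 - q) ^ (n + 1)\<^sup>2 \<le> 1 / (2 * fact (n + 1))"
proof -
  have "fact n \<le> real n ^ n" using fact_le_power[of n, where 'a=real] by simp
  then have "2 * fact (n + 1) \<le> real (n + 1) * (2 * real n ^ n)" by simp
  also have "2 * real n ^ n \<le> real (n + 1) ^ n"
  proof -
    have "2 \<le> (1 + 1 / real n) ^ n"
      using Bernoulli_inequality[of "1 / real n" n] n_pos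
      by (simp add: order_trans[of "-1" 0])
    then have "2 * real n ^ n \<le> (1 + 1 / real n) ^ n * real n ^ n" by (intro mult_right_mono) auto
    also have "\<dots> = real (n + 1) ^ n"
      using n_pos by (simp add: power_mult_distrib[symmetric] distrib_right add.commute)
    finally show ?thesis .
  qed
  finally have f: "2 * fact (n + 1) \<le> real (n + 1) ^ (n + 1)" by simp
  have "ln (1 + 1 / real n) \<le> 1 / real n" by (intro ln_add_one_self_le_self) auto
  moreover have "ln (real (n + 1)) = L + ln (1 + 1 / real n)"
  proof -
    have "real (n + 1) = real n * (1 + 1 / real n)" using n_pos by (simp add: distrib_left)
    then show ?thesis using n_pos unfolding L_def
      by (metis add_pos_nonneg divide_nonneg_nonneg less_numeral_extra(1) ln_mult_pos of_nat_0_le_iff of_nat_0_less_iff zero_le_one)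
  qed
  ultimately have "ln (real (n + 1)) \<le> L + 1 / real n" by simp
  also have "\<dots> \<le> L + L / real n" using L_gt by (simp add: divide_right_mono)
  also have "\<dots> = real (n + 1) * (L / real n)" using n_pos by (simp add: field_simps)
  also have "\<dots> \<le> real (n + 1) * q" using assms by (intro mult_left_mono) auto
  finally have lnq: "ln (real (n + 1)) \<le> real (n + 1) * q" .
  have "(1 - q) ^ (n + 1)\<^sup>2 \<le> exp (- q) ^ (n + 1)\<^sup>2"
    using assms exp_ge_add_one_self[of "- q"] by (intro power_mono) auto
  also have "\<dots> = exp (- (real (n + 1) * (real (n + 1) * q)))"
    by (simp only: exp_of_nat_mult[symmetric] of_nat_power power2_eq_square) (simp add: algebra_simps)
  also have "\<dots> \<le> exp (- (real (n + 1) * ln (real (n + 1))))"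
    using lnq by simp
  also have "\<dots> = 1 / real (n + 1) ^ (n + 1)"
    by (simp only: exp_minus exp_of_nat_mult) (simp add: field_simps)
  also have "\<dots> \<le> 1 / (2 * fact (n + 1))"
    using f by (intro divide_left_mono) auto
  finally show ?thesis .
qed

end

section \<open>Deviations of the estimated trigger time\<close>

text \<open>The error of worker \<open>k\<close> in estimating the time \<open>0\<close> of the trigger; the local clock offset
  cancels.\<close>

definition est :: "real \<Rightarrow> nat \<Rightarrow> (nat \<times> nat \<Rightarrow> real) \<Rightarrow> nat \<Rightarrow> real" where
  "est l n d k = (\<Sum>j\<in>others n k. arrival d j k) / real n - 2 / l"

lemma action_time_eq:
  assumes "1 \<le> n" "k \<in> workers n"
  shows "action_time l n \<Delta> c d k =
    max (recv_time n d k) (\<Delta> + 2 * pa_delta l n * (real k - 1) + est l n d k)"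
  using assms
  by (simp add: action_time_def T_est_def est_def local_clock_def sum.distrib card_others add_divide_distrib)

lemma sum_others:
  fixes g :: "nat \<Rightarrow> real"
  assumes "k \<in> workers n"
  shows "(\<Sum>j\<in>others n k. g j) = (\<Sum>j\<in>workers n. g j) - g k"
  using assms by (simp add: others_def sum_diff1)

lemma fst_msg_pos: "j \<in> others n k \<Longrightarrow> j \<noteq> 0"
  by (auto simp: others_def workers_def)

lemma sum_workers_if:
  fixes g :: "nat \<Rightarrow> real"
  assumes "k \<in> workers n"
  shows "(\<Sum>j\<in>workers n. of_bool (j = k) * g j) = g k"
  using assms by (simp add: of_bool_def if_distrib[of "\<lambda>u. u * _"] sum.delta cong: if_cong)

lemma est_mult:
  assumes "1 \<le> n" "k \<in> workers n"
  shows "real n * est l n d k =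
    (\<Sum>j\<in>workers n. d (0, j)) - d (0, k) + (\<Sum>j\<in>others n k. d (j, k)) - 2 * real n / l"
  using assms by (simp add: est_def arrival_def sum.distrib sum_others right_diff_distrib)

lemma prod_workers_pair:
  fixes g :: "nat \<Rightarrow> real"
  assumes "k \<in> workers n" "k' \<in> workers n" "k \<noteq> k'"
    and "\<And>j. j \<noteq> k \<Longrightarrow> j \<noteq> k' \<Longrightarrow> g j = 1"
  shows "(\<Prod>j\<in>workers n. g j) = g k * g k'"
proof -
  have "(\<Prod>j\<in>workers n. g j) = (\<Prod>j\<in>{k, k'}. g j)"
    by (rule prod.mono_neutral_right) (use assms in auto)
  then show ?thesis using assms by simp
qed

text \<open>Up to a factor and an additive constant, the coefficients of \<open>n (S\<^sub>k - S\<^sub>k')\<close> and \<open>- n S\<^sub>k\<close> as linear forms in the delays. In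
  the difference all trigger delays cancel, except those of \<open>k\<close> and \<open>k'\<close> themselves.\<close>

definition spread_coeff :: "real \<Rightarrow> nat \<Rightarrow> nat \<Rightarrow> nat \<times> nat \<Rightarrow> real" where
  "spread_coeff x k k' i = (if fst i = 0 then - 1 else 1) * x * (of_bool (snd i = k) - of_bool (snd i = k'))"

definition late_coeff :: "real \<Rightarrow> nat \<Rightarrow> nat \<times> nat \<Rightarrow> real" where
  "late_coeff x k i = - x * of_bool ((fst i = 0) \<noteq> (snd i = k))"

text \<open>Each worker hears of every trigger but its own, so the difference keeps
  \<open>d (0, k') - d (0, k)\<close>; hence the reversed sign of trigger tilts.\<close>

lemma sum_spread_coeff:
  assumes "1 \<le> n" "k \<in> workers n" "k' \<in> workers n"
  shows "(\<Sum>i\<in>msgs n. spread_coeff x k k' i * l * d i)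
    = x * l * real n * (est l n d k - est l n d k')"
proof -
  have "(\<Sum>i\<in>msgs n. spread_coeff x k k' i * l * d i)
    = (\<Sum>j\<in>workers n. x * l * (of_bool (j = k') * d (0, j) - of_bool (j = k) * d (0, j)))
    + (\<Sum>j\<in>workers n. \<Sum>i\<in>others n j. x * l * ((of_bool (j = k) - of_bool (j = k')) * d (i, j)))"
    unfolding sum_msgs
    by (intro arg_cong2[where f="(+)"] sum.cong refl) (auto simp: spread_coeff_def algebra_simps dest: fst_msg_pos)
  also have "\<dots> = x * l * (d (0, k') - d (0, k))
    + x * l * (\<Sum>j\<in>workers n. (of_bool (j = k) - of_bool (j = k')) * (\<Sum>i\<in>others n j. d (i, j)))"
    using assms by (simp only: sum_distrib_left[symmetric] sum_subtractf sum_workers_if)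
  also have "(\<Sum>j\<in>workers n. (of_bool (j = k) - of_bool (j = k')) * (\<Sum>i\<in>others n j. d (i, j)))
    = (\<Sum>i\<in>others n k. d (i, k)) - (\<Sum>i\<in>others n k'. d (i, k'))"
    using assms by (simp only: left_diff_distrib sum_subtractf sum_workers_if)
  also have "x * l * (d (0, k') - d (0, k))
    + x * l * ((\<Sum>i\<in>others n k. d (i, k)) - (\<Sum>i\<in>others n k'. d (i, k')))
    = x * l * (real n * est l n d k - real n * est l n d k')"
    using assms by (simp only: est_mult) (simp add: algebra_simps)
  finally show ?thesis by (simp add: algebra_simps)
qed

text \<open>The exclusive or in \<open>late_coeff\<close> selects what worker \<open>k\<close>
  observes: triggers to others and redirects to \<open>k\<close>. These are \<open>2 * n\<close>
  delays of mean \<open>1 / l\<close>, whence the constant.\<close>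

lemma sum_late_coeff:
  assumes "1 \<le> n" "k \<in> workers n" "0 < l"
  shows "(\<Sum>i\<in>msgs n. late_coeff x k i * l * d i) = - x * l * real n * est l n d k - 2 * real n * x"
proof -
  have "(\<Sum>i\<in>msgs n. late_coeff x k i * l * d i)
    = (\<Sum>j\<in>workers n. - x * l * (d (0, j) - of_bool (j = k) * d (0, j)))
    + (\<Sum>j\<in>workers n. \<Sum>i\<in>others n j. - x * l * (of_bool (j = k) * d (i, j)))"
    unfolding sum_msgs
    by (intro arg_cong2[where f="(+)"] sum.cong refl) (auto simp: late_coeff_def dest: fst_msg_pos)
  also have "\<dots> = - x * l * ((\<Sum>j\<in>workers n. d (0, j)) - d (0, k) + (\<Sum>i\<in>others n k. d (i, k)))"
    using assms by (simp only: sum_distrib_left[symmetric] sum_subtractf sum_workers_if) (simp add: algebra_simps)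
  also have "\<dots> = - x * l * (real n * est l n d k + 2 * real n / l)"
    using assms by (simp add: est_mult)
  finally show ?thesis using assms by (simp add: algebra_simps)
qed

text \<open>Tilt \<open>x\<close> occurs at the \<open>n\<close> redirects to \<open>k\<close> and
  the trigger of \<open>k'\<close>, tilt \<open>- x\<close> at the \<open>n\<close> redirects to
  \<open>k'\<close> and the trigger of \<open>k\<close>. This gives \<open>n + 1\<close> opposite
  pairs; all other messages are untilted.\<close>

lemma prod_trunc_mgf_spread:
  assumes b: "0 < b" and x: "0 < x" "x < 1"
    and k: "k \<in> workers n" "k' \<in> workers n" "k \<noteq> k'"
  shows "(\<Prod>i\<in>msgs n. trunc_mgf b (spread_coeff x k k' i))
    \<le> trunc_mgf b 0 ^ (n + 1)\<^sup>2 * (1 / (1 - x\<^sup>2)) ^ (n + 1)"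
proof -
  define \<rho> where "\<rho> s = trunc_mgf b s / trunc_mgf b 0" for s
  have pos: "0 < trunc_mgf b s" if "s < 1" for s using trunc_mgf_pos b that by auto
  have \<rho>0: "\<rho> 0 = 1" using pos[of 0] by (simp add: \<rho>_def)
  have F: "trunc_mgf b s = trunc_mgf b 0 * \<rho> s" for s using pos[of 0] by (simp add: \<rho>_def)
  have "(\<Prod>i\<in>msgs n. trunc_mgf b (spread_coeff x k k' i))
    = trunc_mgf b 0 ^ (n + 1)\<^sup>2 * (\<Prod>i\<in>msgs n. \<rho> (spread_coeff x k k' i))"
    by (subst F) (simp add: prod.distrib card_msgs)
  \<comment> \<open>Sender 1 stands for an arbitrary nonzero sender, since
    \<open>spread_coeff\<close> only tests whether the sender is 0.\<close>
  also have "(\<Prod>i\<in>msgs n. \<rho> (spread_coeff x k k' i))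
    = (\<Prod>j\<in>workers n. \<rho> (spread_coeff x k k' (0, j))) * (\<Prod>j\<in>workers n. \<rho> (spread_coeff x k k' (1, j)) ^ n)"
    unfolding prod_msgs
  proof (intro arg_cong2[where f="(*)"] prod.cong refl)
    fix j assume j: "j \<in> workers n"
    have "(\<Prod>i\<in>others n j. \<rho> (spread_coeff x k k' (i, j))) = (\<Prod>i\<in>others n j. \<rho> (spread_coeff x k k' (1, j)))"
      by (intro prod.cong refl) (auto simp: spread_coeff_def dest: fst_msg_pos)
    then show "(\<Prod>i\<in>others n j. \<rho> (spread_coeff x k k' (i, j))) = \<rho> (spread_coeff x k k' (1, j)) ^ n"
      using j by (simp add: card_others)
  qed
  also have "\<dots> = (\<rho> x * \<rho> (- x)) ^ (n + 1)"
    using k by (simp add: prod_workers_pair spread_coeff_def \<rho>0 power_mult_distrib mult_ac)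
  also have "\<rho> x * \<rho> (- x) \<le> 1 / (1 - x\<^sup>2)"
  proof -
    have "trunc_mgf b x * trunc_mgf b (- x) \<le> (trunc_mgf b 0)\<^sup>2 * (1 / (1 - x\<^sup>2))"
      using b x by (intro trunc_mgf_mult_uminus_le) auto
    then have "trunc_mgf b x * trunc_mgf b (- x) / (trunc_mgf b 0)\<^sup>2 \<le> 1 / (1 - x\<^sup>2)"
      using pos[of 0] by (simp add: pos_divide_le_eq mult.commute)
    then show ?thesis by (simp add: \<rho>_def power2_eq_square)
  qed
  then have "(\<rho> x * \<rho> (- x)) ^ (n + 1) \<le> (1 / (1 - x\<^sup>2)) ^ (n + 1)"
    using pos x by (intro power_mono) (auto simp: \<rho>_def less_imp_le)
  finally show ?thesis using pos[of 0] by (simp add: mult_left_mono)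
qed

lemma prod_trunc_mgf_late:
  assumes b: "0 < b" and x: "0 < x" and k: "k \<in> workers n"
  shows "(\<Prod>i\<in>msgs n. trunc_mgf b (late_coeff x k i))
    \<le> trunc_mgf b 0 ^ (n + 1)\<^sup>2
      * exp (- x + x\<^sup>2 / 2 + x * (b * exp (- b) / (1 - exp (- b)))) ^ (2 * n)"
proof -
  define \<rho> where "\<rho> s = trunc_mgf b s / trunc_mgf b 0" for s
  have pos: "0 < trunc_mgf b s" if "s < 1" for s using trunc_mgf_pos b that by auto
  have \<rho>0: "\<rho> 0 = 1" using pos[of 0] by (simp add: \<rho>_def)
  have F: "trunc_mgf b s = trunc_mgf b 0 * \<rho> s" for s using pos[of 0] by (simp add: \<rho>_def)
  have W: "workers n = insert k (others n k)" "k \<notin> others n k" using k by (auto simp: others_def)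
  have "(\<Prod>i\<in>msgs n. trunc_mgf b (late_coeff x k i))
    = trunc_mgf b 0 ^ (n + 1)\<^sup>2 * (\<Prod>i\<in>msgs n. \<rho> (late_coeff x k i))"
    by (subst F) (simp add: prod.distrib card_msgs)
  also have "(\<Prod>i\<in>msgs n. \<rho> (late_coeff x k i)) = \<rho> (- x) ^ n * \<rho> (- x) ^ n"
    unfolding prod_msgs
  proof (rule arg_cong2[where f="(*)"])
    have "(\<Prod>j\<in>others n k. \<rho> (late_coeff x k (0, j))) = (\<Prod>j\<in>others n k. \<rho> (- x))"
      by (intro prod.cong refl) (auto simp: late_coeff_def others_def)
    then show "(\<Prod>j\<in>workers n. \<rho> (late_coeff x k (0, j))) = \<rho> (- x) ^ n"
      using W k by (simp add: late_coeff_def \<rho>0 card_others)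
    have "(\<Prod>j\<in>workers n. \<Prod>i\<in>others n j. \<rho> (late_coeff x k (i, j)))
      = (\<Prod>j\<in>workers n. if j = k then \<rho> (- x) ^ n else 1)"
    proof (intro prod.cong refl)
      fix j assume j: "j \<in> workers n"
      have "(\<Prod>i\<in>others n j. \<rho> (late_coeff x k (i, j))) = (\<Prod>i\<in>others n j. if j = k then \<rho> (- x) else 1)"
        by (intro prod.cong refl) (auto simp: late_coeff_def \<rho>0 dest: fst_msg_pos)
      then show "(\<Prod>i\<in>others n j. \<rho> (late_coeff x k (i, j))) = (if j = k then \<rho> (- x) ^ n else 1)"
        using j by (simp add: card_others)
    qed
    then show "(\<Prod>j\<in>workers n. \<Prod>i\<in>others n j. \<rho> (late_coeff x k (i, j))) = \<rho> (- x) ^ n"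
      using k by simp
  qed
  also have "\<dots> = \<rho> (- x) ^ (2 * n)" by (simp add: mult_2 power_add)
  also have "\<rho> (- x) ^ (2 * n)
    \<le> exp (- x + x\<^sup>2 / 2 + x * (b * exp (- b) / (1 - exp (- b)))) ^ (2 * n)"
    using trunc_mgf_uminus_le[of b x] b x pos[of 0] pos[of "- x"]
    by (intro power_mono) (auto simp: \<rho>_def pos_divide_le_eq mult.commute)
  finally show ?thesis using pos[of 0] by (simp add: mult_left_mono)
qed

lemma sorting_permutation:
  fixes f :: "nat \<Rightarrow> 'a::linorder"
  obtains p where "p permutes workers n" "\<And>k. k \<in> {1..n} \<Longrightarrow> f (p k) \<le> f (p (Suc k))"
proof -
  define xs where "xs = sort_key f [1..<n + 2]"
  have len: "length xs = n + 1" and set: "set xs = workers n" and dist: "distinct xs"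
    by (auto simp: xs_def workers_def)
  have sorted: "sorted (map f xs)" by (simp add: xs_def)
  \<comment> \<open>List positions start at 0, workers at 1.\<close>
  define p where "p k = (if k \<in> workers n then xs ! (k - 1) else k)" for k
  have "bij_betw (\<lambda>i. xs ! i) {..<n + 1} (workers n)"
    using bij_betw_nth[OF dist] len set by simp
  moreover have "bij_betw (\<lambda>k. k - 1) (workers n) {..<n + 1}"
    by (rule bij_betw_byWitness[of _ Suc]) (auto simp: workers_def)
  ultimately have "bij_betw (\<lambda>k. xs ! (k - 1)) (workers n) (workers n)"
    using bij_betw_trans by (fastforce simp: comp_def)
  then have "bij_betw p (workers n) (workers n)"
    by (simp add: p_def cong: bij_betw_cong)
  then have "p permutes workers n"
    by (rule bij_imp_permutes) (simp add: p_def)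
  moreover have "f (p k) \<le> f (p (Suc k))" if "k \<in> {1..n}" for k
    using sorted_nth_mono[OF sorted, of "k - 1" k] that len by (simp add: p_def workers_def)
  ultimately show ?thesis by (rule that)
qed

section \<open>Effect of renaming on collection times and estimates\<close>

context
  fixes n :: nat and p :: "nat \<Rightarrow> nat"
  assumes p: "p permutes workers n"
begin

lemma others_image: "k \<in> workers n \<Longrightarrow> others n (p k) = p ` others n k"
  unfolding others_def
  using permutes_image[OF p] permutes_inj[OF p] by (simp add: image_set_diff)

lemma arrival_relabel:
  assumes "k \<in> workers n" "j \<in> others n k"
  shows "arrival (relabel n p d) j k = arrival d (p j) (p k)"
  using assms others_in_workers[OF assms(2)] by (simp add: arrival_def relabel_def permutes_workers_0[OF p])

lemma recv_time_relabel: "k \<in> workers n \<Longrightarrow> recv_time n (relabel n p d) k = recv_time n d (p k)"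
  by (simp add: recv_time_def others_image image_image arrival_relabel cong: image_cong_simp)

lemma est_relabel: "k \<in> workers n \<Longrightarrow> est l n (relabel n p d) k = est l n d (p k)"
  using permutes_inj[OF p]
  by (simp add: est_def others_image sum.reindex inj_on_subset[OF _ subset_UNIV] arrival_relabel)

lemma relabel_bounded:
  assumes "\<forall>i\<in>msgs n. d i \<le> m"
  shows "\<forall>i\<in>msgs n. relabel n p d i \<le> m"
  using assms map_prod_in_msgs[OF p] by (auto simp: relabel_def)

end

section \<open>Measurability\<close>

lemma measurable_recv_time [measurable]:
  assumes "0 < l" "k \<in> workers n"
  shows "(\<lambda>d. recv_time n d k) \<in> borel_measurable (delay_space l n)"
  unfolding recv_time_def arrival_def using assms
  by (intro borel_measurable_Max borel_measurable_add measurable_delay)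
     (auto dest: others_in_workers)

lemma measurable_est [measurable]:
  assumes "0 < l" "k \<in> workers n"
  shows "(\<lambda>d. est l n d k) \<in> borel_measurable (delay_space l n)"
  unfolding est_def arrival_def using assms
  by (intro borel_measurable_diff borel_measurable_divide borel_measurable_sum
      borel_measurable_add measurable_delay borel_measurable_const)
     (auto dest: others_in_workers)

lemma Suc_in_workers: "k \<in> {1..n} \<Longrightarrow> k \<in> workers n \<and> Suc k \<in> workers n"
  by (auto simp: workers_def)

lemma measurable_correct_run:
  assumes "0 < l" "1 \<le> n"
  shows "{d \<in> space (delay_space l n). correct_run l n \<Delta> c d} \<in> sets (delay_space l n)"
proof -
  have [measurable]: "(\<lambda>d. action_time l n \<Delta> c d k) \<in> borel_measurable (delay_space l n)"
    if "k \<in> workers n" for k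
    unfolding action_time_eq[OF assms(2) that] using assms that by measurable
  show ?thesis
    unfolding correct_run_def
    by (intro sets.sets_Collect_finite_All finite_atLeastAtMost borel_measurable_le)
       (use Suc_in_workers in \<open>auto intro!: borel_measurable_le\<close>)
qed

section \<open>Chernoff bounds for the estimates\<close>

context
  fixes l :: real and n :: nat and m x :: real
  assumes l: "0 < l" and n: "1 \<le> n" and m: "0 < m" and x: "0 < x" "x < 1"
begin

text \<open>The probability that all delays are at most \<open>m\<close> stays as a factor, so that
  the bound is a fraction of it.\<close>

lemma prob_spread_le:
  assumes k: "k \<in> workers n" "k' \<in> workers n" "k \<noteq> k'"
  shows "measure (delay_space l n) {d \<in> space (delay_space l n).
      (\<forall>i\<in>msgs n. d i \<le> m) \<and> \<eta> \<le> est l n d k - est l n d k'}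
    \<le> (1 - exp (- (l * m))) ^ (n + 1)\<^sup>2
      * (exp (- (x * l * real n * \<eta>)) * (1 / (1 - x\<^sup>2)) ^ (n + 1))"
proof -
  have "x * l * real n * \<eta> \<le> x * l * real n * (est l n d k - est l n d k') \<longleftrightarrow>
      \<eta> \<le> est l n d k - est l n d k'" for d
    using x l n by (subst mult_le_cancel_left_pos) auto
  then have "measure (delay_space l n) {d \<in> space (delay_space l n).
      (\<forall>i\<in>msgs n. d i \<le> m) \<and> \<eta> \<le> est l n d k - est l n d k'}
    = measure (delay_space l n) {d \<in> space (delay_space l n).
      (\<forall>i\<in>msgs n. d i \<le> m) \<and> x * l * real n * \<eta> \<le> (\<Sum>i\<in>msgs n. spread_coeff x k k' i * l * d i)}"
    using n k by (simp add: sum_spread_coeff)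
  also have "\<dots> \<le> exp (- (x * l * real n * \<eta>)) * (\<Prod>i\<in>msgs n. trunc_mgf (l * m) (spread_coeff x k k' i))"
    using m x k by (intro chernoff_all_le l) (auto simp: spread_coeff_def)
  also have "\<dots> \<le> exp (- (x * l * real n * \<eta>)) * (trunc_mgf (l * m) 0 ^ (n + 1)\<^sup>2 * (1 / (1 - x\<^sup>2)) ^ (n + 1))"
    using m x k l by (intro mult_left_mono prod_trunc_mgf_spread) auto
  finally show ?thesis by (simp only: trunc_mgf_0 mult.left_commute)
qed

lemma prob_late_le:
  assumes k: "k \<in> workers n"
  shows "measure (delay_space l n) {d \<in> space (delay_space l n).
      (\<forall>i\<in>msgs n. d i \<le> m) \<and> \<eta> \<le> - est l n d k}
    \<le> (1 - exp (- (l * m))) ^ (n + 1)\<^sup>2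
      * (exp (- (x * l * real n * \<eta>) + 2 * real n * x)
        * exp (- x + x\<^sup>2 / 2 + x * (l * m * exp (- (l * m)) / (1 - exp (- (l * m))))) ^ (2 * n))"
proof -
  have "x * l * real n * \<eta> - 2 * real n * x \<le> - x * l * real n * est l n d k - 2 * real n * x \<longleftrightarrow>
      \<eta> \<le> - est l n d k" for d
  proof -
    have "x * l * real n * \<eta> \<le> x * l * real n * (- est l n d k) \<longleftrightarrow> \<eta> \<le> - est l n d k"
      using x l n by (subst mult_le_cancel_left_pos) auto
    then show ?thesis by simp
  qed
  then have "measure (delay_space l n) {d \<in> space (delay_space l n).
      (\<forall>i\<in>msgs n. d i \<le> m) \<and> \<eta> \<le> - est l n d k}
    = measure (delay_space l n) {d \<in> space (delay_space l n).
      (\<forall>i\<in>msgs n. d i \<le> m) \<and> x * l * real n * \<eta> - 2 * real n * x \<le> (\<Sum>i\<in>msgs n. late_coeff x k i * l * d i)}"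
    using n k l by (simp only: sum_late_coeff)
  also have "\<dots> \<le> exp (- (x * l * real n * \<eta> - 2 * real n * x)) * (\<Prod>i\<in>msgs n. trunc_mgf (l * m) (late_coeff x k i))"
    using m x k by (intro chernoff_all_le l) (auto simp: late_coeff_def)
  also have "\<dots> \<le> exp (- (x * l * real n * \<eta> - 2 * real n * x)) * (trunc_mgf (l * m) 0 ^ (n + 1)\<^sup>2
      * exp (- x + x\<^sup>2 / 2 + x * (l * m * exp (- (l * m)) / (1 - exp (- (l * m))))) ^ (2 * n))"
    using m x k l by (intro mult_left_mono prod_trunc_mgf_late) auto
  also have "- (x * l * real n * \<eta> - 2 * real n * x) = - (x * l * real n * \<eta>) + 2 * real n * x" by simp
  finally show ?thesis by (simp only: trunc_mgf_0 mult.left_commute)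
qed

end

section \<open>Sufficient conditions for a correct run, and symmetry among orders\<close>

lemma recv_time_le:
  assumes "1 \<le> n" "k \<in> workers n" "\<forall>i\<in>msgs n. d i \<le> m"
  shows "recv_time n d k \<le> 2 * m"
proof -
  have "others n k \<noteq> {}" using card_others[OF assms(2)] assms(1) by auto
  moreover have "arrival d j k \<le> 2 * m" if "j \<in> others n k" for j
  proof -
    have "(0, j) \<in> msgs n" "(j, k) \<in> msgs n"
      using that assms(2) others_in_workers[OF that] by auto
    then have "d (0, j) \<le> m" "d (j, k) \<le> m" using assms(3) by blast+
    then show ?thesis by (simp add: arrival_def)
  qed
  ultimately show ?thesis by (simp add: recv_time_def)
qed

text \<open>Two hops end by \<open>\<Delta>\<close>. The waiting target of \<open>Suc k\<close>
  exceeds that of \<open>k\<close>, and it also exceeds \<open>\<Delta>\<close>, because its slot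
  \<open>2 * pa_delta l n * k\<close> outweighs the negative part of the error. So it dominates both
  arguments of the maximum for \<open>k\<close>.\<close>

lemma correct_run_if_bounded:
  assumes "0 < l" "1 \<le> n" "\<forall>i\<in>msgs n. d i \<le> \<Delta> / 2"
    and "\<And>k. k \<in> {1..n} \<Longrightarrow> est l n d k - est l n d (Suc k) < 2 * pa_delta l n"
    and "\<And>k. k \<in> {1..n} \<Longrightarrow> - est l n d (Suc k) < 2 * pa_delta l n"
  shows "correct_run l n \<Delta> c d"
  unfolding correct_run_def
proof
  fix k assume k: "k \<in> {1..n}"
  have W: "k \<in> workers n" "Suc k \<in> workers n" using Suc_in_workers[OF k] by auto
  have "0 \<le> pa_delta l n" using assms by (simp add: pa_delta_def)
  moreover have "1 \<le> real k" using k by simp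
  ultimately have "pa_delta l n * 1 \<le> pa_delta l n * real k" by (rule mult_left_mono[rotated])
  then show "action_time l n \<Delta> c d k \<le> action_time l n \<Delta> c d (Suc k)"
    unfolding action_time_eq[OF assms(2) W(1)] action_time_eq[OF assms(2) W(2)]
    using recv_time_le[OF assms(2) W(1) assms(3)] assms(4)[OF k] assms(5)[OF k]
    by (simp add: algebra_simps max_def)
qed

text \<open>Both arguments of the maximum in \<open>action_time\<close> increase from
  \<open>k\<close> to \<open>Suc k\<close>.\<close>

lemma correct_run_if_sorted:
  assumes "1 \<le> n"
    and "\<And>k. k \<in> {1..n} \<Longrightarrow> est l n d k - est l n d (Suc k) < 2 * pa_delta l n"
    and "\<And>k. k \<in> {1..n} \<Longrightarrow> recv_time n d k \<le> recv_time n d (Suc k)"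
  shows "correct_run l n \<Delta> c d"
  unfolding correct_run_def
proof
  fix k assume k: "k \<in> {1..n}"
  have W: "k \<in> workers n" "Suc k \<in> workers n" using Suc_in_workers[OF k] by auto
  show "action_time l n \<Delta> c d k \<le> action_time l n \<Delta> c d (Suc k)"
    unfolding action_time_eq[OF assms(1) W(1)] action_time_eq[OF assms(1) W(2)]
    using assms(2,3)[OF k] by (intro max.mono) (auto simp: algebra_simps)
qed

text \<open>Every outcome becomes sorted under some renaming, and by symmetry the
  \<open>fact (n + 1)\<close> events obtained this way are equally likely. Ties only make these
  events overlap, which the union bound permits.\<close>

lemma prob_le_fact_prob_sorted:
  assumes l: "0 < l" and n: "1 \<le> n"
    and Q: "Measurable.pred (delay_space l n) Q"
    and inv: "\<And>p d. p permutes workers n \<Longrightarrow> Q d \<Longrightarrow> Q (relabel n p d)"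
  shows "measure (delay_space l n) {d \<in> space (delay_space l n). Q d}
    \<le> fact (n + 1) * measure (delay_space l n) {d \<in> space (delay_space l n).
        Q d \<and> (\<forall>k\<in>{1..n}. recv_time n d k \<le> recv_time n d (Suc k))}"
proof -
  interpret prob_space "delay_space l n" by (rule prob_space_delay[OF l])
  let ?M = "delay_space l n"
  let ?S = "\<lambda>d. Q d \<and> (\<forall>k\<in>{1..n}. recv_time n d k \<le> recv_time n d (Suc k))"
  let ?B = "\<lambda>p. {d \<in> space ?M. ?S (relabel n p d)}"
  let ?Perm = "{p. p permutes workers n}"
  note Q [measurable]
  have [measurable]: "Measurable.pred ?M (\<lambda>d. recv_time n d k \<le> recv_time n d (Suc k))"
    if "k \<in> {1..n}" for k
    using Suc_in_workers[OF that] l unfolding pred_def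
    by (intro borel_measurable_le measurable_recv_time) auto
  have S [measurable]: "Measurable.pred ?M ?S" by measurable
  have fin: "finite ?Perm" by (simp add: finite_permutations)
  have eq: "prob (?B p) = prob {d \<in> space ?M. ?S d}" if "p \<in> ?Perm" for p
    using measure_relabel[OF l _ S, of p] that unfolding relabel_def by simp
  have meas: "?B p \<in> sets ?M" if "p \<in> ?Perm" for p
  proof -
    have "relabel n p \<in> ?M \<rightarrow>\<^sub>M ?M"
      using measurable_relabel[OF l, of p] that by simp
    from measurable_compose[OF this S] show ?thesis by (simp add: pred_def)
  qed
  have "prob {d \<in> space ?M. Q d} \<le> prob (\<Union>p\<in>?Perm. ?B p)"
  proof (intro finite_measure_mono)
    show "(\<Union>p\<in>?Perm. ?B p) \<in> sets ?M" using fin meas by (intro sets.finite_UN) auto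
    show "{d \<in> space ?M. Q d} \<subseteq> (\<Union>p\<in>?Perm. ?B p)"
    proof
      fix d assume d: "d \<in> {d \<in> space ?M. Q d}"
      obtain p where p: "p permutes workers n"
        and s: "\<And>k. k \<in> {1..n} \<Longrightarrow> recv_time n d (p k) \<le> recv_time n d (p (Suc k))"
        using sorting_permutation[of n "recv_time n d"] by blast
      have "?S (relabel n p d)"
        using d inv[OF p] s Suc_in_workers by (auto simp: recv_time_relabel[OF p])
      then show "d \<in> (\<Union>p\<in>?Perm. ?B p)" using d p by blast
    qed
  qed
  also have "\<dots> \<le> (\<Sum>p\<in>?Perm. prob (?B p))"
    using fin meas by (intro finite_measure_subadditive_finite) auto
  also have "\<dots> = real (card ?Perm) * prob {d \<in> space ?M. ?S d}"
    using eq by simp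
  also have "card ?Perm = fact (n + 1)"
    by (intro card_permutations) (auto simp: workers_def)
  finally show ?thesis by (simp only: of_nat_fact)
qed

section \<open>Probability of a correct run\<close>

context
  fixes n :: nat and l L r x :: real
  assumes L_def: "L = ln (real n)" and r_def: "r = sqrt (real n)" and x_def: "x = L / (2 * r)"
    and L_gt: "4 < L" and l: "0 < l"
begin

lemmas parameters = L_def r_def x_def L_gt

text \<open>Determines the Chernoff exponent: at tilt \<open>x\<close> a deviation by
  \<open>2 * pa_delta l n\<close> costs \<open>L^2\<close>.\<close>

lemma x_mult_delta: "x * l * real n * (2 * pa_delta l n) = L\<^sup>2"
proof -
  have "real n = r\<^sup>2" by (simp add: r_def)
  then show ?thesis
    unfolding pa_delta_def L_def[symmetric] r_def[symmetric] x_def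
    using r_pos[OF parameters] l by (simp add: power2_eq_square)
qed

lemma prob_spread_le_exp:
  assumes "0 < m" "k \<in> workers n" "k' \<in> workers n" "k \<noteq> k'"
  shows "measure (delay_space l n) {d \<in> space (delay_space l n).
      (\<forall>i\<in>msgs n. d i \<le> m) \<and> 2 * pa_delta l n \<le> est l n d k - est l n d k'}
    \<le> (1 - exp (- (l * m))) ^ (n + 1)\<^sup>2 * exp (- ((7/10) * L\<^sup>2))"
proof (rule order_trans[OF prob_spread_le[of l n m x k k']])
  show "(1 - exp (- (l * m))) ^ (n + 1)\<^sup>2 * (exp (- (x * l * real n * (2 * pa_delta l n))) * (1 / (1 - x\<^sup>2)) ^ (n + 1))
    \<le> (1 - exp (- (l * m))) ^ (n + 1)\<^sup>2 * exp (- ((7/10) * L\<^sup>2))"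
    unfolding x_mult_delta using spread_bound[OF parameters] assms l by (intro mult_left_mono) auto
qed (use assms l x_bounds[OF parameters] n_pos[OF parameters] in auto)

lemma prob_late_le_exp:
  assumes "0 < m" "k \<in> workers n" "exp (- (l * m)) < L / real n"
  shows "measure (delay_space l n) {d \<in> space (delay_space l n).
      (\<forall>i\<in>msgs n. d i \<le> m) \<and> 2 * pa_delta l n \<le> - est l n d k}
    \<le> (1 - exp (- (l * m))) ^ (n + 1)\<^sup>2 * exp (- ((7/20) * L\<^sup>2))"
proof (rule order_trans[OF prob_late_le[of l n m x k]])
  have "l * m * exp (- (l * m)) / (1 - exp (- (l * m))) \<le> (2/5) * L / r"
    using assms l by (intro truncation_shift_bound[OF parameters]) auto
  from late_bound[OF parameters this]
  show "(1 - exp (- (l * m))) ^ (n + 1)\<^sup>2 * (exp (- (x * l * real n * (2 * pa_delta l n)) + 2 * real n * x)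
        * exp (- x + x\<^sup>2 / 2 + x * (l * m * exp (- (l * m)) / (1 - exp (- (l * m))))) ^ (2 * n))
    \<le> (1 - exp (- (l * m))) ^ (n + 1)\<^sup>2 * exp (- ((7/20) * L\<^sup>2))"
    unfolding x_mult_delta using assms l by (intro mult_left_mono) auto
qed (use assms l x_bounds[OF parameters] n_pos[OF parameters] in auto)

text \<open>The event of small delays is covered by correct runs and the failure events
  \<open>S k\<close> and \<open>E k\<close>. These are taken inside it, so each bound carries the
  factor \<open>P\<close>, which can be pulled out.\<close>

lemma prob_correct_large_delta:
  assumes "0 < \<Delta>" "exp (- (l * (\<Delta> / 2))) < L / real n"
  shows "(1 - real n * exp (- (L\<^sup>2 / 4))) * (1 - exp (- (l * (\<Delta> / 2)))) ^ (n + 1)\<^sup>2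
    \<le> measure (delay_space l n) {d \<in> space (delay_space l n). correct_run l n \<Delta> c d}"
proof -
  let ?M = "delay_space l n"
  interpret prob_space ?M by (rule prob_space_delay[OF l])
  define m where "m = \<Delta> / 2"
  have m: "0 < m" using assms by (simp add: m_def)
  have n: "1 \<le> n" using n_pos[OF parameters] by simp
  define P where "P = (1 - exp (- (l * m))) ^ (n + 1)\<^sup>2"
  have P: "0 \<le> P" using l m by (simp add: P_def)
  let ?A = "{d \<in> space ?M. \<forall>i\<in>msgs n. d i \<le> m}"
  let ?C = "{d \<in> space ?M. correct_run l n \<Delta> c d}"
  define S where "S k = {d \<in> space ?M. (\<forall>i\<in>msgs n. d i \<le> m) \<and> 2 * pa_delta l n \<le> est l n d k - est l n d (Suc k)}" for k
  define E where "E k = {d \<in> space ?M. (\<forall>i\<in>msgs n. d i \<le> m) \<and> 2 * pa_delta l n \<le> - est l n d (Suc k)}" for k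
  note [measurable] = measurable_delay[OF l] measurable_est[OF l]
  have C: "?C \<in> sets ?M" by (rule measurable_correct_run[OF l n])
  have SE: "S k \<in> sets ?M" "E k \<in> sets ?M" if "k \<in> {1..n}" for k
  proof -
    have [measurable]: "k \<in> workers n" "Suc k \<in> workers n" using Suc_in_workers[OF that] by auto
    show "S k \<in> sets ?M" "E k \<in> sets ?M" unfolding S_def E_def by measurable
  qed
  have bad: "(\<Union>k\<in>{1..n}. S k \<union> E k) \<in> sets ?M" using SE by auto
  have "P = prob ?A" using measure_all_le[OF l, of m n] m by (simp add: P_def)
  also have "\<dots> \<le> prob (?C \<union> (\<Union>k\<in>{1..n}. S k \<union> E k))"
  proof (intro finite_measure_mono)
    show "?A \<subseteq> ?C \<union> (\<Union>k\<in>{1..n}. S k \<union> E k)"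
    proof
      fix d assume d: "d \<in> ?A"
      show "d \<in> ?C \<union> (\<Union>k\<in>{1..n}. S k \<union> E k)"
      proof (cases "\<exists>k\<in>{1..n}. d \<in> S k \<union> E k")
        case False
        have "correct_run l n \<Delta> c d"
        proof (rule correct_run_if_bounded[OF l n])
          show "\<forall>i\<in>msgs n. d i \<le> \<Delta> / 2" using d by (simp add: m_def)
          fix k assume k: "k \<in> {1..n}"
          then have "d \<notin> S k" "d \<notin> E k" using False by blast+
          then show "est l n d k - est l n d (Suc k) < 2 * pa_delta l n" "- est l n d (Suc k) < 2 * pa_delta l n"
            using d by (auto simp: S_def E_def not_le[symmetric])
        qed
        then show ?thesis using d by blast
      qed blast
    qed
  qed (use C bad in auto)
  also have "\<dots> \<le> prob ?C + prob (\<Union>k\<in>{1..n}. S k \<union> E k)"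
    using C bad by (intro measure_Un_le) auto
  also have "prob (\<Union>k\<in>{1..n}. S k \<union> E k) \<le> (\<Sum>k\<in>{1..n}. prob (S k \<union> E k))"
    using SE by (intro finite_measure_subadditive_finite) auto
  also have "\<dots> \<le> (\<Sum>k\<in>{1..n}. P * exp (- (L\<^sup>2 / 4)))"
  proof (intro sum_mono)
    fix k assume k: "k \<in> {1..n}"
    have "prob (S k \<union> E k) \<le> prob (S k) + prob (E k)"
      using SE[OF k] by (intro measure_Un_le) auto
    also have "\<dots> \<le> P * exp (- ((7/10) * L\<^sup>2)) + P * exp (- ((7/20) * L\<^sup>2))"
      using Suc_in_workers[OF k] m assms(2) unfolding P_def S_def E_def
      by (intro add_mono prob_spread_le_exp prob_late_le_exp) (auto simp: m_def)
    also have "\<dots> \<le> P * exp (- (L\<^sup>2 / 4))"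
      using union_bound_adjacent[OF parameters] P by (simp add: distrib_left[symmetric] mult_left_mono)
    finally show "prob (S k \<union> E k) \<le> P * exp (- (L\<^sup>2 / 4))" .
  qed
  finally have "P \<le> prob ?C + real n * (P * exp (- (L\<^sup>2 / 4)))" by simp
  then show ?thesis unfolding m_def[symmetric] P_def[symmetric] by (simp add: algebra_simps)
qed

text \<open>A bound uniform in \<open>\<Delta>\<close>: runs with close estimates and collection
  times in worker order are correct for every \<open>\<Delta>\<close>.\<close>

lemma prob_correct_ge_inverse_fact:
  "1 / (2 * fact (n + 1)) \<le> measure (delay_space l n) {d \<in> space (delay_space l n). correct_run l n \<Delta> c d}"
proof -
  let ?M = "delay_space l n"
  interpret prob_space ?M by (rule prob_space_delay[OF l])
  define N where "N = (n + 1)\<^sup>2"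
  \<comment> \<open>An auxiliary truncation unrelated to \<open>\<Delta>\<close>: each of the
    \<open>N\<close> messages exceeds \<open>m\<close> with probability \<open>1 / (4 * N)\<close>,
    so all stay below it with probability at least 3/4.\<close>
  define m where "m = ln (4 * real N) / l"
  have N: "1 \<le> N" by (simp add: N_def)
  have m: "0 < m" using l N by (simp add: m_def)
  have n: "1 \<le> n" using n_pos[OF parameters] by simp
  define P where "P = (1 - exp (- (l * m))) ^ N"
  have "exp (- (l * m)) = 1 / (4 * real N)"
    using l N by (simp add: m_def exp_minus inverse_eq_divide)
  then have "P = (1 + - (1 / (4 * real N))) ^ N" by (simp add: P_def)
  also have "\<dots> \<ge> 1 + real N * - (1 / (4 * real N))"
    using N by (intro Bernoulli_inequality) (simp add: field_simps)
  finally have P: "3 / 4 \<le> P" using N by simp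
  let ?A = "{d \<in> space ?M. \<forall>i\<in>msgs n. d i \<le> m}"
  \<comment> \<open>All ordered pairs are required, not only neighbours, to make \<open>Q\<close>
    invariant under renaming.\<close>
  define Q where "Q = (\<lambda>d. (\<forall>i\<in>msgs n. d i \<le> m) \<and>
    (\<forall>k\<in>workers n. \<forall>k'\<in>others n k. est l n d k - est l n d k' < 2 * pa_delta l n))"
  let ?Q = "{d \<in> space ?M. Q d}"
  let ?S = "\<lambda>(k, k'). {d \<in> space ?M. (\<forall>i\<in>msgs n. d i \<le> m) \<and> 2 * pa_delta l n \<le> est l n d k - est l n d k'}"
  let ?I = "Sigma (workers n) (others n)"
  note [measurable] = measurable_delay[OF l] measurable_est[OF l] others_in_workers
  have Q [measurable]: "Measurable.pred ?M Q" unfolding Q_def by measurable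
  have S: "?S i \<in> sets ?M" if "i \<in> ?I" for i
  proof -
    have [measurable]: "fst i \<in> workers n" "snd i \<in> workers n" using that others_in_workers by auto
    show ?thesis unfolding case_prod_beta by measurable
  qed
  have "P = prob ?A" using measure_all_le[OF l, of m n] m by (simp add: P_def N_def)
  also have "\<dots> \<le> prob (?Q \<union> (\<Union>i\<in>?I. ?S i))"
  proof (intro finite_measure_mono)
    show "?A \<subseteq> ?Q \<union> (\<Union>i\<in>?I. ?S i)" by (auto simp: Q_def not_less)
  qed (use S in auto)
  also have "\<dots> \<le> prob ?Q + prob (\<Union>i\<in>?I. ?S i)"
    using S by (intro measure_Un_le) auto
  also have "prob (\<Union>i\<in>?I. ?S i) \<le> (\<Sum>i\<in>?I. prob (?S i))"
    using S by (intro finite_measure_subadditive_finite) auto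
  also have "\<dots> \<le> (\<Sum>i\<in>?I. P * exp (- ((7/10) * L\<^sup>2)))"
  proof (intro sum_mono)
    fix i assume i: "i \<in> ?I"
    then obtain k k' where [simp]: "i = (k, k')" by (cases i)
    have "k \<in> workers n" "k' \<in> workers n" "k \<noteq> k'" using i by (auto simp: others_def)
    then show "prob (?S i) \<le> P * exp (- ((7/10) * L\<^sup>2))"
      using prob_spread_le_exp[OF m, of k k'] by (simp add: P_def N_def)
  qed
  also have "\<dots> = P * (real (n + 1) * real n * exp (- ((7/10) * L\<^sup>2)))"
  proof -
    have "card ?I = (n + 1) * n" by (simp add: card_others) (simp add: workers_def)
    then show ?thesis by (simp add: algebra_simps)
  qed
  also have "\<dots> \<le> P * (1 / 4)"
    using union_bound_all_pairs[OF parameters] P by (intro mult_left_mono) auto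
  finally have "P \<le> prob ?Q + P * (1 / 4)" by simp
  \<comment> \<open>Three quarters of \<open>P \<ge> 3 / 4\<close> is 9/16.\<close>
  then have half: "1 / 2 \<le> prob ?Q" using P by simp
  have "prob ?Q \<le> fact (n + 1) * prob {d \<in> space ?M. Q d \<and> (\<forall>k\<in>{1..n}. recv_time n d k \<le> recv_time n d (Suc k))}"
  proof (rule prob_le_fact_prob_sorted[OF l n Q])
    fix p d assume p: "p permutes workers n" and d: "Q d"
    have "est l n (relabel n p d) k - est l n (relabel n p d) k' < 2 * pa_delta l n"
      if k: "k \<in> workers n" "k' \<in> others n k" for k k'
    proof -
      have "p k \<in> workers n" "p k' \<in> others n (p k)"
        using k permutes_in_image[OF p] others_image[OF p k(1)] by auto
      then show ?thesis
        using d k others_in_workers[OF k(2)] by (auto simp: Q_def est_relabel[OF p])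
    qed
    then show "Q (relabel n p d)"
      using d relabel_bounded[OF p] by (simp add: Q_def)
  qed
  also have "\<dots> \<le> fact (n + 1) * prob {d \<in> space ?M. correct_run l n \<Delta> c d}"
  proof (intro mult_left_mono finite_measure_mono measurable_correct_run l n subsetI)
    fix d assume "d \<in> {d \<in> space ?M. Q d \<and> (\<forall>k\<in>{1..n}. recv_time n d k \<le> recv_time n d (Suc k))}"
    then show "d \<in> {d \<in> space ?M. correct_run l n \<Delta> c d}"
      by (auto simp: Q_def others_def workers_def intro!: correct_run_if_sorted[OF n])
  qed simp
  finally have "1 / 2 \<le> fact (n + 1) * prob {d \<in> space ?M. correct_run l n \<Delta> c d}"
    using half by linarith
  then show ?thesis by (simp add: field_simps del: fact_Suc)
qed

end

theorem theorem6:
  fixes l \<Delta> :: real and n :: nat and c :: "nat \<Rightarrow> real"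
  assumes "l > 0" and "\<Delta> > 0" and "n \<ge> 1"
  shows "measure (delay_space l n)
           {d \<in> space (delay_space l n). correct_run l n \<Delta> c d}
         \<ge> Psi n * (1 - exp (- (1/2) * l * \<Delta>)) ^ ((n + 1)^2)"
proof (cases "ln (real n) \<le> 4")
  case True
  then show ?thesis using Psi_eq_0[OF assms(3)] by simp
next
  case False
  define L r x where "L = ln (real n)" and "r = sqrt (real n)" and "x = L / (2 * r)"
  have L: "4 < L" using False by (simp add: L_def)
  define q where "q = exp (- (l * (\<Delta> / 2)))"
  have q: "0 < q" "q < 1" using assms by (auto simp: q_def)
  have q_eq: "exp (- (1/2) * l * \<Delta>) = q" by (simp add: q_def)
  let ?C = "measure (delay_space l n) {d \<in> space (delay_space l n). correct_run l n \<Delta> c d}"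
  have Psi: "Psi n \<le> max 0 (1 - real n * exp (- (L\<^sup>2 / 4)))"
    using Psi_le[OF assms(3)] by (simp add: L_def)
  have "Psi n * (1 - q) ^ (n + 1)\<^sup>2 \<le> ?C"
  proof (cases "q < L / real n")
    case True
    have "Psi n * (1 - q) ^ (n + 1)\<^sup>2 \<le> max 0 (1 - real n * exp (- (L\<^sup>2 / 4))) * (1 - q) ^ (n + 1)\<^sup>2"
      using Psi q by (intro mult_right_mono) auto
    \<comment> \<open>The maximum with 0 covers the case of a negative first factor.\<close>
    also have "\<dots> \<le> max 0 ?C"
      using prob_correct_large_delta[OF L_def r_def x_def L assms(1,2) True[unfolded q_def], of c]
      unfolding q_def[symmetric] by (auto simp: max_def)
    finally show ?thesis by simp
  next
    case False
    \<comment> \<open>The power of \<open>1 - q\<close> alone is already small enough here.\<close>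
    have "Psi n \<le> 1" using Psi by (rule order_trans) simp
    then have "Psi n * (1 - q) ^ (n + 1)\<^sup>2 \<le> 1 * (1 - q) ^ (n + 1)\<^sup>2"
      using q by (intro mult_right_mono) auto
    also have "\<dots> \<le> 1 / (2 * fact (n + 1))"
      using all_small_prob_le_fact[OF L_def r_def x_def L, of q] q False by simp
    also have "\<dots> \<le> ?C" by (rule prob_correct_ge_inverse_fact[OF L_def r_def x_def L assms(1)])
    finally show ?thesis .
  qed
  then show ?thesis unfolding q_eq .
qed

end
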